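(* Let $X_1,X_2$ be compact metric spaces and let $\mathcal{A}_1,\mathcal{A}_2$ be unital primitive $C^*$-algebras. Then a map $J:\mathrm{Lip}(X_1,\mathcal{A}_1)\to\mathrm{Lip}(X_2,\mathcal{A}_2)$ is a Jordan $*$-isomorphism that is continuous with respect to the norms $\|\cdot\|_L$ if and only if there exist a lipeomorphism $\varphi:X_2\to X_1$ and a Jordan $*$-isomorphism $V_y:\mathcal{A}_1\to\mathcal{A}_2$ for each $y\in X_2$, where the maps $X_2\ni y\mapsto V_y$ and $X_1\ni x\mapsto V^{-1}_{\varphi^{-1}(x)}$ are Lipschitz continuous with respect to the strong operator topology, such that $$JF(y)=V_y(F(\varphi(y)))$$ for all $F\in\mathrm{Lip}(X_1,\mathcal{A}_1)$ and $y\in X_2$.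
   Context: For a compact metric space $(X,d)$ and a unital $C^*$-algebra $\mathcal{A}$, $\mathrm{Lip}(X,\mathcal{A})$ is the set of all $F:X\to\mathcal{A}$ with $L(F):=\sup_{x\ne y}\frac{\|F(x)-F(y)\|_{\mathcal{A}}}{d(x,y)}<\infty$. It is a Banach $*$-algebra with pointwise operations, involution $F^*(x)=[F(x)]^*$ and norm $\|F\|_L=\sup_{x\in X}\|F(x)\|_{\mathcal{A}}+L(F)$. A $C^*$-algebra is called primitive if its zero ideal is primitive, i.e. if it has a faithful non-zero irreducible representation. The Jordan product in a $*$-algebra is $a\circ b=\frac{ab+ba}{2}$. A Jordan $*$-homomorphism between $*$-algebras is a (complex) linear map $J$ with $J(a\circ b)=J(a)\circ J(b)$ for all $a,b$ and $J(a^* )=J(a)^*$ for all $a$. A Jordan $*$-isomorphism is a bijective Jordan $*$-homomorphism. A lipeomorphism is a bijective Lipschitz map whose inverse is also Lipschitz. For a metric space $X$ and $C^*$-algebras $\mathcal{C},\mathcal{D}$, let $B(\mathcal{C},\mathcal{D})$ be the set of bounded linear operators from $\mathcal{C}$ into $\mathcal{D}$. A map $X\to B(\mathcal{C},\mathcal{D})$, $y\mapsto W_y$, is Lipschitz continuous with respect to the strong operator topology if there is a positive real number $K$ such that $\|W_y(a)-W_z(a)\|\le K\|a\|d(y,z)$ for all $a\in\mathcal{C}$ and all $y,z\in X$. This is applied to $y\mapsto V_y\in B(\mathcal{A}_1,\mathcal{A}_2)$ and to $x\mapsto V^{-1}_{\varphi^{-1}(x)}\in B(\mathcal{A}_2,\mathcal{A}_1)$,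 where $V^{-1}_{\varphi^{-1}(x)}$ is the inverse of the bijection $V_{\varphi^{-1}(x)}$. *)

theory Defs
  imports "HOL-Analysis.Analysis"
begin

class complex_vector = real_vector +
  fixes scaleC :: "complex \<Rightarrow> 'a \<Rightarrow> 'a"  (infixr \<open>*\<^sub>C\<close> 75)
  assumes scaleC_add_right: "c *\<^sub>C (x + y) = c *\<^sub>C x + c *\<^sub>C y"
    and scaleC_add_left: "(c + d) *\<^sub>C x = c *\<^sub>C x + d *\<^sub>C x"
    and scaleC_scaleC: "c *\<^sub>C d *\<^sub>C x = (c * d) *\<^sub>C x"
    and scaleC_one: "1 *\<^sub>C x = x"
    and scaleR_scaleC: "r *\<^sub>R x = complex_of_real r *\<^sub>C x"

class complex_star_algebra = complex_vector + ring +
  fixes star :: "'a \<Rightarrow> 'a"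
  assumes mult_scaleC_left: "(c *\<^sub>C x) * y = c *\<^sub>C (x * y)"
    and mult_scaleC_right: "x * (c *\<^sub>C y) = c *\<^sub>C (x * y)"
    and star_add: "star (x + y) = star x + star y"
    and star_scaleC: "star (c *\<^sub>C x) = cnj c *\<^sub>C star x"
    and star_mult: "star (x * y) = star y * star x"
    and star_star: "star (star x) = x"

text \<open>The class \<^class>\<open>real_normed_algebra_1\<close> contains \<open>1 \<noteq> 0\<close>, so the zero algebra is not an
  instance. It has no non-zero representation and hence is not primitive.\<close>

class unital_cstar_algebra = complex_star_algebra + real_normed_algebra_1 + banach +
  assumes norm_scaleC: "norm (c *\<^sub>C x) = cmod c * norm x"
    and cstar_identity: "norm (star x * x) = (norm x)\<^sup>2"

class complex_hilbert_space = complex_vector + banach +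
  fixes cinner :: "'a \<Rightarrow> 'a \<Rightarrow> complex"
  assumes cinner_commute: "cinner x y = cnj (cinner y x)"
    and cinner_add_left: "cinner (x + y) z = cinner x z + cinner y z"
    and cinner_scaleC_left: "cinner (c *\<^sub>C x) y = c * cinner x y"
    and cinner_self: "cinner x x = complex_of_real ((norm x)\<^sup>2)"

definition bounded_clinear ::
    "('a::{complex_vector,real_normed_vector} \<Rightarrow> 'b::{complex_vector,real_normed_vector}) \<Rightarrow> bool" where
  "bounded_clinear f \<longleftrightarrow> bounded_linear f \<and> (\<forall>c x. f (c *\<^sub>C x) = c *\<^sub>C f x)"

definition representation ::
    "('a::unital_cstar_algebra \<Rightarrow> 'h::complex_hilbert_space \<Rightarrow> 'h) \<Rightarrow> bool" where
  "representation \<pi> \<longleftrightarrow>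
     (\<forall>a. bounded_clinear (\<pi> a)) \<and>
     (\<forall>a b \<xi>. \<pi> (a + b) \<xi> = \<pi> a \<xi> + \<pi> b \<xi>) \<and>
     (\<forall>c a \<xi>. \<pi> (c *\<^sub>C a) \<xi> = c *\<^sub>C \<pi> a \<xi>) \<and>
     (\<forall>a b \<xi>. \<pi> (a * b) \<xi> = \<pi> a (\<pi> b \<xi>)) \<and>
     (\<forall>a \<xi> \<eta>. cinner (\<pi> a \<xi>) \<eta> = cinner \<xi> (\<pi> (star a) \<eta>))"

definition closed_csubspace :: "'h::complex_hilbert_space set \<Rightarrow> bool" where
  "closed_csubspace S \<longleftrightarrow> closed S \<and> 0 \<in> S \<and>
     (\<forall>\<xi>\<in>S. \<forall>\<eta>\<in>S. \<xi> + \<eta> \<in> S) \<and> (\<forall>c. \<forall>\<xi>\<in>S. c *\<^sub>C \<xi> \<in> S)"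

definition nonzero_irreducible_representation ::
    "('a::unital_cstar_algebra \<Rightarrow> 'h::complex_hilbert_space \<Rightarrow> 'h) \<Rightarrow> bool" where
  "nonzero_irreducible_representation \<pi> \<longleftrightarrow>
     representation \<pi> \<and> (\<exists>a \<xi>. \<pi> a \<xi> \<noteq> 0) \<and>
     (\<forall>S. closed_csubspace S \<and> (\<forall>a. \<forall>\<xi>\<in>S. \<pi> a \<xi> \<in> S) \<longrightarrow> S = {0} \<or> S = UNIV)"

text \<open>A formula of HOL cannot quantify over all Hilbert spaces, so the Hilbert space of the
  representation is a type parameter. A theorem that assumes \<open>primitive_cstar_on\<close> for a free type
  variable \<open>'h\<close> holds for every \<open>'h\<close>; its hypothesis is therefore exactly that some
  Hilbert space carries a faithful non-zero irreducible representation.\<close>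

definition primitive_cstar_on ::
    "'a::unital_cstar_algebra itself \<Rightarrow> 'h::complex_hilbert_space itself \<Rightarrow> bool" where
  "primitive_cstar_on A H \<longleftrightarrow>
     (\<exists>\<pi> :: 'a \<Rightarrow> 'h \<Rightarrow> 'h. nonzero_irreducible_representation \<pi> \<and> inj \<pi>)"

definition jordan_prod :: "'a::complex_star_algebra \<Rightarrow> 'a \<Rightarrow> 'a" where
  "jordan_prod a b = (1 / 2) *\<^sub>C (a * b + b * a)"

definition jordan_star_hom :: "('a::complex_star_algebra \<Rightarrow> 'b::complex_star_algebra) \<Rightarrow> bool" where
  "jordan_star_hom J \<longleftrightarrow>
     (\<forall>a b. J (a + b) = J a + J b) \<and>
     (\<forall>c a. J (c *\<^sub>C a) = c *\<^sub>C J a) \<and>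
     (\<forall>a b. J (jordan_prod a b) = jordan_prod (J a) (J b)) \<and>
     (\<forall>a. J (star a) = star (J a))"

definition jordan_star_iso :: "('a::complex_star_algebra \<Rightarrow> 'b::complex_star_algebra) \<Rightarrow> bool" where
  "jordan_star_iso J \<longleftrightarrow> jordan_star_hom J \<and> bij J"

definition lipeomorphism :: "('x::metric_space \<Rightarrow> 'y::metric_space) \<Rightarrow> bool" where
  "lipeomorphism f \<longleftrightarrow>
     bij f \<and> (\<exists>C. C-lipschitz_on UNIV f) \<and> (\<exists>C. C-lipschitz_on UNIV (inv f))"

definition sot_lipschitz ::
    "('x::metric_space \<Rightarrow> 'c::unital_cstar_algebra \<Rightarrow> 'd::unital_cstar_algebra) \<Rightarrow> bool" where
  "sot_lipschitz W \<longleftrightarrow>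
     (\<forall>y. bounded_clinear (W y)) \<and>
     (\<exists>K>0. \<forall>a y z. norm (W y a - W z a) \<le> K * norm a * dist y z)"

class compact_metric_space = metric_space +
  assumes compact_space: "compact (UNIV :: 'a set)"

definition lip_quotients :: "('x::metric_space \<Rightarrow> 'a::real_normed_vector) \<Rightarrow> real set" where
  "lip_quotients F = {norm (F x - F y) / dist x y | x y. x \<noteq> y}"

text \<open>Inserting \<open>0\<close> does not change a supremum of non-negative numbers; it only fixes
  \<open>L(F) = 0\<close> on a one-point space, where there are no quotients.\<close>

definition lip_seminorm :: "('x::metric_space \<Rightarrow> 'a::real_normed_vector) \<Rightarrow> real" where
  "lip_seminorm F = Sup (insert 0 (lip_quotients F))"

lemma lip_quotients_bound:
  assumes "\<And>x y. norm (F x - F y) \<le> K * dist x y"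
  shows "bdd_above (lip_quotients F)" and "0 \<le> K \<Longrightarrow> lip_seminorm F \<le> K"
proof -
  have *: "q \<le> K" if "q \<in> lip_quotients F" for q
    using that assms by (auto simp: lip_quotients_def divide_le_eq)
  show "bdd_above (lip_quotients F)"
    using * by (rule bdd_aboveI)
  show "lip_seminorm F \<le> K" if "0 \<le> K"
    unfolding lip_seminorm_def using * that by (intro cSup_least) auto
qed

lemma lip_seminorm_bound:
  assumes "bdd_above (lip_quotients F)"
  shows "norm (F x - F y) \<le> lip_seminorm F * dist x y"
proof (cases "x = y")
  case False
  then have "norm (F x - F y) / dist x y \<le> lip_seminorm F"
    unfolding lip_seminorm_def using assms
    by (intro cSup_upper) (auto simp: lip_quotients_def)
  with False show ?thesis by (simp add: divide_le_eq)
qed simp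

lemma lip_seminorm_nonneg: "bdd_above (lip_quotients F) \<Longrightarrow> 0 \<le> lip_seminorm F"
  unfolding lip_seminorm_def by (intro cSup_upper) auto

typedef (overloaded) ('x, 'a) lip =
  "{F :: 'x::compact_metric_space \<Rightarrow> 'a::unital_cstar_algebra. bdd_above (lip_quotients F)}"
  morphisms lip_apply Lip
proof
  have "bdd_above (lip_quotients (\<lambda>_::'x. 0::'a))"
    by (rule lip_quotients_bound(1)[where K = 0]) simp
  then show "(\<lambda>_. 0) \<in> {F :: 'x \<Rightarrow> 'a. bdd_above (lip_quotients F)}" by simp
qed

setup_lifting type_definition_lip

lemma lip_eqI: "(\<And>x. lip_apply F x = lip_apply G x) \<Longrightarrow> F = G"
  by (rule iffD1[OF lip_apply_inject]) (rule ext)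

lemma lip_apply_bound:
  "norm (lip_apply F x - lip_apply F y) \<le> lip_seminorm (lip_apply F) * dist x y"
  using lip_apply[of F] by (auto intro: lip_seminorm_bound)

lemma lip_seminorm_apply_nonneg: "0 \<le> lip_seminorm (lip_apply F)"
  using lip_apply[of F] by (auto intro: lip_seminorm_nonneg)

lemma lipschitz_bdd_above_norm:
  fixes F :: "'x::compact_metric_space \<Rightarrow> 'a::real_normed_vector"
  assumes "bdd_above (lip_quotients F)"
  shows "bdd_above (range (\<lambda>x. norm (F x)))"
proof -
  have "(lip_seminorm F)-lipschitz_on UNIV F"
    using lip_seminorm_bound[OF assms] lip_seminorm_nonneg[OF assms]
    by (auto simp: lipschitz_on_def dist_norm)
  then have "continuous_on UNIV F" by (rule lipschitz_on_continuous_on)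
  then have "compact (range F)" by (rule compact_continuous_image) (rule compact_space)
  then have "bounded (range F)" by (rule compact_imp_bounded)
  then obtain B where "norm (F x) \<le> B" for x by (auto simp: bounded_iff)
  then show ?thesis by (auto intro: bdd_aboveI[where M = B])
qed

lemma norm_star:
  fixes a :: "'a::unital_cstar_algebra"
  shows "norm (star a) = norm a"
proof -
  have le: "norm b \<le> norm (star b)" for b :: 'a
  proof (cases "b = 0")
    case False
    have "norm b * norm b \<le> norm (star b) * norm b"
      using cstar_identity[of b] norm_mult_ineq[of "star b" b] by (simp add: power2_eq_square)
    with False show ?thesis by simp
  qed simp
  show ?thesis using le[of a] le[of "star a"] by (simp add: star_star)
qed

lemma star_diff:
  fixes a b :: "'a::complex_star_algebra"
  shows "star (a - b) = star a - star b"
  using star_add[of "a - b" b] by (simp add: algebra_simps)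

lemma scaleC_diff_right:
  fixes a b :: "'a::complex_vector"
  shows "c *\<^sub>C (a - b) = c *\<^sub>C a - c *\<^sub>C b"
  using scaleC_add_right[of c "a - b" b] by (simp add: algebra_simps)

lemma bdd_lip_quotients_add:
  assumes "bdd_above (lip_quotients F)" "bdd_above (lip_quotients G)"
  shows "bdd_above (lip_quotients (\<lambda>x. F x + G x))"
    and "lip_seminorm (\<lambda>x. F x + G x) \<le> lip_seminorm F + lip_seminorm G"
proof -
  have *: "norm ((F x + G x) - (F y + G y)) \<le> (lip_seminorm F + lip_seminorm G) * dist x y" for x y
    using norm_diff_triangle_ineq[of "F x" "G x" "F y" "G y"]
      lip_seminorm_bound[OF assms(1), of x y] lip_seminorm_bound[OF assms(2), of x y]
    by (simp add: algebra_simps)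
  show "bdd_above (lip_quotients (\<lambda>x. F x + G x))"
    using * by (rule lip_quotients_bound(1))
  show "lip_seminorm (\<lambda>x. F x + G x) \<le> lip_seminorm F + lip_seminorm G"
    using * by (rule lip_quotients_bound(2))
      (simp add: lip_seminorm_nonneg[OF assms(1)] lip_seminorm_nonneg[OF assms(2)])
qed

lemma bdd_lip_quotients_scaleC:
  fixes F :: "'x::metric_space \<Rightarrow> 'a::unital_cstar_algebra"
  assumes "bdd_above (lip_quotients F)"
  shows "bdd_above (lip_quotients (\<lambda>x. c *\<^sub>C F x))"
    and "lip_seminorm (\<lambda>x. c *\<^sub>C F x) \<le> cmod c * lip_seminorm F"
proof -
  have *: "norm (c *\<^sub>C F x - c *\<^sub>C F y) \<le> (cmod c * lip_seminorm F) * dist x y" for x y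
    using mult_left_mono[OF lip_seminorm_bound[OF assms, of x y], of "cmod c"]
    by (simp add: norm_scaleC mult.assoc flip: scaleC_diff_right)
  show "bdd_above (lip_quotients (\<lambda>x. c *\<^sub>C F x))"
    using * by (rule lip_quotients_bound(1))
  show "lip_seminorm (\<lambda>x. c *\<^sub>C F x) \<le> cmod c * lip_seminorm F"
    using * by (rule lip_quotients_bound(2)) (simp add: lip_seminorm_nonneg[OF assms])
qed

lemma bdd_lip_quotients_minus:
  "bdd_above (lip_quotients (\<lambda>x. - F x)) = bdd_above (lip_quotients F)"
proof -
  have "lip_quotients (\<lambda>x. - F x) = lip_quotients F"
    by (simp add: lip_quotients_def norm_minus_commute)
  then show ?thesis by simp
qed

lemma bdd_lip_quotients_mult:
  fixes F G :: "'x::compact_metric_space \<Rightarrow> 'a::real_normed_algebra"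
  assumes F: "bdd_above (lip_quotients F)" and G: "bdd_above (lip_quotients G)"
  shows "bdd_above (lip_quotients (\<lambda>x. F x * G x))"
proof -
  obtain M where M: "norm (F x) \<le> M" for x
    using lipschitz_bdd_above_norm[OF F] by (auto simp: bdd_above_def)
  obtain N where N: "norm (G x) \<le> N" for x
    using lipschitz_bdd_above_norm[OF G] by (auto simp: bdd_above_def)
  have "norm (F x * G x - F y * G y) \<le> (M * lip_seminorm G + lip_seminorm F * N) * dist x y" for x y
  proof -
    have "F x * G x - F y * G y = F x * (G x - G y) + (F x - F y) * G y"
      by (simp add: algebra_simps)
    then have "norm (F x * G x - F y * G y)
        \<le> norm (F x) * norm (G x - G y) + norm (F x - F y) * norm (G y)"
      by (auto intro!: norm_triangle_le add_mono norm_mult_ineq)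
    also have "\<dots> \<le> M * (lip_seminorm G * dist x y) + (lip_seminorm F * dist x y) * N"
      using M[of x] N[of y] lip_seminorm_bound[OF F, of x y] lip_seminorm_bound[OF G, of x y]
        lip_seminorm_nonneg[OF F] order_trans[OF norm_ge_zero M[of x]]
      by (intro add_mono mult_mono) auto
    finally show ?thesis by (simp add: algebra_simps)
  qed
  then show ?thesis by (rule lip_quotients_bound(1))
qed

lemma bdd_lip_quotients_star:
  fixes F :: "'x::metric_space \<Rightarrow> 'a::unital_cstar_algebra"
  assumes "bdd_above (lip_quotients F)"
  shows "bdd_above (lip_quotients (\<lambda>x. star (F x)))"
proof -
  have "lip_quotients (\<lambda>x. star (F x)) = lip_quotients F"
    by (simp add: lip_quotients_def norm_star flip: star_diff)
  with assms show ?thesis by simp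
qed

instantiation lip :: (compact_metric_space, unital_cstar_algebra) complex_star_algebra
begin

lift_definition zero_lip :: "('a, 'b) lip" is "\<lambda>_. 0"
  by (rule lip_quotients_bound(1)[where K = 0]) simp

lift_definition plus_lip :: "('a, 'b) lip \<Rightarrow> ('a, 'b) lip \<Rightarrow> ('a, 'b) lip"
  is "\<lambda>F G x. F x + G x" by (rule bdd_lip_quotients_add(1))

lift_definition uminus_lip :: "('a, 'b) lip \<Rightarrow> ('a, 'b) lip"
  is "\<lambda>F x. - F x" by (simp add: bdd_lip_quotients_minus)

lift_definition minus_lip :: "('a, 'b) lip \<Rightarrow> ('a, 'b) lip \<Rightarrow> ('a, 'b) lip"
  is "\<lambda>F G x. F x - G x"
  subgoal for F G
    using bdd_lip_quotients_add(1)[of F "\<lambda>x. - G x"] by (simp add: bdd_lip_quotients_minus)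
  done

lift_definition times_lip :: "('a, 'b) lip \<Rightarrow> ('a, 'b) lip \<Rightarrow> ('a, 'b) lip"
  is "\<lambda>F G x. F x * G x" by (rule bdd_lip_quotients_mult)

lift_definition scaleC_lip :: "complex \<Rightarrow> ('a, 'b) lip \<Rightarrow> ('a, 'b) lip"
  is "\<lambda>c F x. c *\<^sub>C F x" by (rule bdd_lip_quotients_scaleC(1))

lift_definition scaleR_lip :: "real \<Rightarrow> ('a, 'b) lip \<Rightarrow> ('a, 'b) lip"
  is "\<lambda>r F x. r *\<^sub>R F x"
  by (simp add: scaleR_scaleC bdd_lip_quotients_scaleC(1))

lift_definition star_lip :: "('a, 'b) lip \<Rightarrow> ('a, 'b) lip"
  is "\<lambda>F x. star (F x)" by (rule bdd_lip_quotients_star)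

instance
proof
  fix F G H :: "('a, 'b) lip" and c d :: complex and r s :: real
  show "F + G + H = F + (G + H)" by transfer (simp add: algebra_simps)
  show "F + G = G + F" by transfer (simp add: algebra_simps)
  show "0 + F = F" by transfer simp
  show "- F + F = 0" by transfer simp
  show "F - G = F + - G" by transfer simp
  show "r *\<^sub>R (F + G) = r *\<^sub>R F + r *\<^sub>R G" by transfer (simp add: algebra_simps)
  show "(r + s) *\<^sub>R F = r *\<^sub>R F + s *\<^sub>R F" by transfer (simp add: algebra_simps)
  show "r *\<^sub>R s *\<^sub>R F = (r * s) *\<^sub>R F" by transfer simp
  show "1 *\<^sub>R F = F" by transfer simp
  show "c *\<^sub>C (F + G) = c *\<^sub>C F + c *\<^sub>C G" by transfer (simp add: scaleC_add_right)
  show "(c + d) *\<^sub>C F = c *\<^sub>C F + d *\<^sub>C F" by transfer (simp add: scaleC_add_left)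
  show "c *\<^sub>C d *\<^sub>C F = (c * d) *\<^sub>C F" by transfer (simp add: scaleC_scaleC)
  show "1 *\<^sub>C F = F" by transfer (simp add: scaleC_one)
  show "r *\<^sub>R F = complex_of_real r *\<^sub>C F" by transfer (simp add: scaleR_scaleC)
  show "F * G * H = F * (G * H)" by transfer (simp add: mult.assoc)
  show "(F + G) * H = F * H + G * H" by transfer (simp add: distrib_right)
  show "F * (G + H) = F * G + F * H" by transfer (simp add: distrib_left)
  show "(c *\<^sub>C F) * G = c *\<^sub>C (F * G)" by transfer (simp add: mult_scaleC_left)
  show "F * (c *\<^sub>C G) = c *\<^sub>C (F * G)" by transfer (simp add: mult_scaleC_right)
  show "star (F + G) = star F + star G" by transfer (simp add: star_add)
  show "star (c *\<^sub>C F) = cnj c *\<^sub>C star F" by transfer (simp add: star_scaleC)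
  show "star (F * G) = star G * star F" by transfer (simp add: star_mult)
  show "star (star F) = F" by transfer (simp add: star_star)
qed

end

lemma bdd_above_norm_lip: "bdd_above (range (\<lambda>x. norm (lip_apply F x)))"
  using lip_apply[of F] by (auto intro: lipschitz_bdd_above_norm)

lemma norm_lip_apply_le_SUP: "norm (lip_apply F x) \<le> (SUP x. norm (lip_apply F x))"
  by (rule cSUP_upper[OF UNIV_I bdd_above_norm_lip])

instantiation lip :: (compact_metric_space, unital_cstar_algebra) real_normed_vector
begin

definition norm_lip :: "('a, 'b) lip \<Rightarrow> real" where
  "norm_lip F = (SUP x. norm (lip_apply F x)) + lip_seminorm (lip_apply F)"

definition sgn_lip :: "('a, 'b) lip \<Rightarrow> ('a, 'b) lip" where
  "sgn_lip F = inverse (norm F) *\<^sub>R F"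

definition dist_lip :: "('a, 'b) lip \<Rightarrow> ('a, 'b) lip \<Rightarrow> real" where
  "dist_lip F G = norm (F - G)"

definition uniformity_lip :: "(('a, 'b) lip \<times> ('a, 'b) lip) filter" where
  "uniformity_lip = (INF e\<in>{0<..}. principal {(F, G). dist F G < e})"

definition open_lip :: "('a, 'b) lip set \<Rightarrow> bool" where
  "open_lip U \<longleftrightarrow> (\<forall>F\<in>U. eventually (\<lambda>(F', G). F' = F \<longrightarrow> G \<in> U) uniformity)"

instance
proof
  fix F G :: "('a, 'b) lip" and r :: real and U :: "('a, 'b) lip set"
  show "sgn F = F /\<^sub>R norm F" by (rule sgn_lip_def)
  show "dist F G = norm (F - G)" by (rule dist_lip_def)
  show "(uniformity :: (('a, 'b) lip \<times> ('a, 'b) lip) filter)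
      = (INF e\<in>{0<..}. principal {(F, G). dist F G < e})" by (rule uniformity_lip_def)
  show "open U \<longleftrightarrow> (\<forall>F\<in>U. \<forall>\<^sub>F (F', G) in uniformity. F' = F \<longrightarrow> G \<in> U)" by (rule open_lip_def)
  have nonneg: "0 \<le> (SUP x. norm (lip_apply H x))" for H :: "('a, 'b) lip"
    using order_trans[OF norm_ge_zero norm_lip_apply_le_SUP] .
  show "norm F = 0 \<longleftrightarrow> F = 0"
  proof
    assume "norm F = 0"
    then have "(SUP x. norm (lip_apply F x)) = 0"
      using nonneg[of F] lip_seminorm_apply_nonneg[of F] by (simp add: norm_lip_def)
    then have "lip_apply F x = 0" for x
      using norm_lip_apply_le_SUP[of F x] by simp
    then show "F = 0" by (intro lip_eqI) (simp add: zero_lip.rep_eq)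
  next
    assume "F = 0"
    moreover have "lip_seminorm (\<lambda>_::'a. 0::'b) \<le> 0"
      by (rule lip_quotients_bound(2)) simp_all
    ultimately show "norm F = 0"
      using lip_seminorm_apply_nonneg[of F] by (simp add: norm_lip_def zero_lip.rep_eq)
  qed
  show "norm (F + G) \<le> norm F + norm G"
  proof -
    have "(SUP x. norm (lip_apply (F + G) x))
        \<le> (SUP x. norm (lip_apply F x)) + (SUP x. norm (lip_apply G x))"
      by (intro cSUP_least)
        (auto simp: plus_lip.rep_eq intro!: norm_triangle_le add_mono norm_lip_apply_le_SUP)
    moreover have "lip_seminorm (lip_apply (F + G))
        \<le> lip_seminorm (lip_apply F) + lip_seminorm (lip_apply G)"
      unfolding plus_lip.rep_eq using lip_apply[of F] lip_apply[of G]
      by (intro bdd_lip_quotients_add(2)) auto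
    ultimately show ?thesis by (simp add: norm_lip_def)
  qed
  have le: "norm (t *\<^sub>R H) \<le> \<bar>t\<bar> * norm H" for t and H :: "('a, 'b) lip"
  proof -
    have "(SUP x. norm (lip_apply (t *\<^sub>R H) x)) \<le> \<bar>t\<bar> * (SUP x. norm (lip_apply H x))"
      by (intro cSUP_least)
        (auto simp: scaleR_lip.rep_eq intro!: mult_left_mono norm_lip_apply_le_SUP)
    moreover have "lip_seminorm (lip_apply (t *\<^sub>R H)) \<le> \<bar>t\<bar> * lip_seminorm (lip_apply H)"
      unfolding scaleR_lip.rep_eq unfolding scaleR_scaleC
      using bdd_lip_quotients_scaleC(2)[of "lip_apply H" "complex_of_real t"] lip_apply[of H]
      by simp
    ultimately show ?thesis by (simp add: norm_lip_def distrib_left)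
  qed
  show "norm (r *\<^sub>R F) = \<bar>r\<bar> * norm F"
  proof (cases "r = 0")
    case True
    with le[of 0 F] nonneg[of "0 *\<^sub>R F"] lip_seminorm_apply_nonneg[of "0 *\<^sub>R F"]
    show ?thesis by (simp add: norm_lip_def)
  next
    case False
    have "\<bar>r\<bar> * norm F = \<bar>r\<bar> * norm (inverse r *\<^sub>R r *\<^sub>R F)" using False by simp
    also have "\<dots> \<le> \<bar>r\<bar> * (\<bar>inverse r\<bar> * norm (r *\<^sub>R F))"
      by (intro mult_left_mono le) simp
    also have "\<dots> = norm (r *\<^sub>R F)" using False by simp
    finally show ?thesis using le[of r F] by linarith
  qed
qed

end

end

theory Submission
  imports Defs
begin

text \<open>Since \<open>[[a, b], c]\<close> is a Jordan expression, a Jordan isomorphism \<open>J\<close> preserves centers. The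
  center of a primitive C*-algebra consists of scalars (Schur's lemma), so the center of the
  Lipschitz algebra is the algebra of scalar Lipschitz functions. On it, \<open>J\<close> followed by evaluation
  at \<open>y\<close> is a character, hence evaluation at a point \<open>\<phi> y\<close>. Multiplying by scalar functions
  peaking at \<open>\<phi> y\<close> and using boundedness of \<open>J\<close> together with the C*-identity shows that \<open>J F y\<close>
  depends only on \<open>F (\<phi> y)\<close>, so \<open>V y a = J a y\<close> for constants \<open>a\<close>. The inverse of \<open>J\<close> is bounded by the
  open mapping theorem and has the same form, which gives the statements about the inverses.\<close>

section \<open>Schur's lemma for irreducible representations\<close>

text \<open>Two obstacles shape the argument. \<open>J\<close> controls anticommutators and squares
  but not products such as \<open>star a * a\<close>, so the C*-identity is used at self-adjoint
  values, where it reads \<open>norm (a * a) = (norm a)^2\<close>. And the Lipschitz norm is not a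
  C*-norm: damping a function that vanishes at \<open>\<phi> y\<close> by a narrow peak of height 1
  makes its supremum small but leaves its Lipschitz constant merely bounded, so boundedness of
  \<open>J\<close> says nothing useful about the damped function itself. Its square does tend to
  zero, since each term of the product rule pairs a bounded slope with a small value. Schur's lemma
  rests on order: irreducibility forces each self-adjoint \<open>T - t\<close> in the commutant to
  have a sign, and these signs cut the real line at the scalar. Scalar functions are taken
  real-valued because \<open>star\<close> fixes them, so \<open>J\<close> sends them to real
  multiples of 1 at each point. Distance functions are of this kind and already determine
  \<open>\<phi>\<close>, its Lipschitz constant and its inverse.\<close>

lemma cinner_add_right:
  fixes x :: "'h::complex_hilbert_space"
  shows "cinner x (y + z) = cinner x y + cinner x z"
  by (metis cinner_commute cinner_add_left complex_cnj_add)

lemma cinner_scaleR_left: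
  fixes x :: "'h::complex_hilbert_space"
  shows "cinner (r *\<^sub>R x) y = of_real r * cinner x y"
  by (simp add: scaleR_scaleC cinner_scaleC_left)

lemma cinner_diff_left:
  fixes x :: "'h::complex_hilbert_space"
  shows "cinner (x - y) z = cinner x z - cinner y z"
  using cinner_add_left[of "x - y" y z] by simp

lemma cinner_diff_right:
  fixes x :: "'h::complex_hilbert_space"
  shows "cinner x (y - z) = cinner x y - cinner x z"
  using cinner_add_right[of x "y - z" z] by simp

lemma cinner_minus_left:
  fixes x :: "'h::complex_hilbert_space"
  shows "cinner (- x) y = - cinner x y"
  using cinner_diff_left[of 0 0 y] cinner_diff_left[of 0 x y] by simp

lemma cinner_scaleR_right:
  fixes x :: "'h::complex_hilbert_space"
  shows "cinner x (r *\<^sub>R y) = of_real r * cinner x y"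
  by (metis cinner_commute cinner_scaleR_left complex_cnj_complex_of_real complex_cnj_mult)

lemma Re_cinner_commute:
  fixes x :: "'h::complex_hilbert_space"
  shows "Re (cinner x y) = Re (cinner y x)"
  by (metis cinner_commute complex_cnj(1) complex.sel(1) complex.exhaust_sel)

lemma norm_add_squared:
  fixes x :: "'h::complex_hilbert_space"
  shows "(norm (x + y))\<^sup>2 = (norm x)\<^sup>2 + 2 * Re (cinner x y) + (norm y)\<^sup>2"
proof -
  have "(norm (x + y))\<^sup>2 = Re (cinner (x + y) (x + y))" by (simp add: cinner_self)
  also have "\<dots> = Re (cinner x x) + Re (cinner x y) + Re (cinner y x) + Re (cinner y y)"
    by (simp add: cinner_add_left cinner_add_right)
  finally show ?thesis by (simp add: cinner_self Re_cinner_commute[of y x])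
qed

lemma Re_cinner_le:
  fixes x :: "'h::complex_hilbert_space"
  shows "Re (cinner x y) \<le> norm x * norm y"
proof -
  have "(norm (x + y))\<^sup>2 \<le> (norm x + norm y)\<^sup>2"
    by (intro power_mono norm_triangle_ineq) simp
  then show ?thesis by (simp add: norm_add_squared power2_sum)
qed

lemma norm_diff_squared:
  fixes x :: "'h::complex_hilbert_space"
  shows "(norm (x - y))\<^sup>2 = (norm x)\<^sup>2 - 2 * Re (cinner x y) + (norm y)\<^sup>2"
  using norm_add_squared[of "x - y" y] by (simp add: cinner_diff_left cinner_self)

section \<open>Square roots of operators by a convergent iteration\<close>

fun sqrt_iter :: "('a::banach \<Rightarrow>\<^sub>L 'a) \<Rightarrow> nat \<Rightarrow> ('a \<Rightarrow>\<^sub>L 'a)" where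
  "sqrt_iter h 0 = 0"
| "sqrt_iter h (Suc n) = (1/2) *\<^sub>R (h + (sqrt_iter h n o\<^sub>L sqrt_iter h n))"

fun sqrt_iter_real :: "nat \<Rightarrow> real" where
  "sqrt_iter_real 0 = 0"
| "sqrt_iter_real (Suc n) = (1/2) * (1 + (sqrt_iter_real n)\<^sup>2)"

lemma sqrt_iter_real_bounds: "0 \<le> sqrt_iter_real n" "sqrt_iter_real n \<le> 1"
proof (induction n)
  case (Suc n)
  { case 1 show ?case by simp }
  { case 2
    have "(sqrt_iter_real n)\<^sup>2 \<le> 1\<^sup>2" using Suc by (intro power_mono)
    then show ?case by simp }
qed auto

text \<open>Each iterate is a polynomial in \<open>h\<close>. In the limit this places the square
  root in the bicommutant of \<open>h\<close>.\<close>

lemma sqrt_iter_commute: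
  assumes "h o\<^sub>L s = s o\<^sub>L h"
  shows "sqrt_iter h n o\<^sub>L s = s o\<^sub>L sqrt_iter h n"
proof (induction n)
  case (Suc n)
  let ?r = "sqrt_iter h n"
  have a: "blinfun_apply h (s x) = s (h x)" for x using assms by (metis blinfun_apply_blinfun_compose)
  have b: "blinfun_apply ?r (s x) = s (?r x)" for x using Suc by (metis blinfun_apply_blinfun_compose)
  show ?case
    by (rule blinfun_eqI) (simp add: a b blinfun.bilinear_simps)
qed (simp add: blinfun_eqI)

lemma sqrt_iter_norm:
  assumes "norm h \<le> 1"
  shows "norm (sqrt_iter h n) \<le> sqrt_iter_real n"
proof (induction n)
  case (Suc n)
  have "norm (sqrt_iter h n o\<^sub>L sqrt_iter h n) \<le> (sqrt_iter_real n)\<^sup>2"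
    unfolding power2_eq_square
    by (rule order_trans[OF norm_blinfun_compose]) (intro mult_mono Suc; simp add: sqrt_iter_real_bounds)
  then have "norm (h + (sqrt_iter h n o\<^sub>L sqrt_iter h n)) \<le> 1 + (sqrt_iter_real n)\<^sup>2"
    using assms norm_triangle_ineq[of h "sqrt_iter h n o\<^sub>L sqrt_iter h n"] by linarith
  then show ?case by simp
qed simp

text \<open>Iterates commute, so a difference of squares factors as \<open>(a - b)(a + b)\<close>.
  Both factors are dominated by their real counterparts, whose increments telescope to a summable
  series.\<close>

lemma sqrt_iter_step:
  assumes "norm h \<le> 1"
  shows "norm (sqrt_iter h (Suc n) - sqrt_iter h n) \<le> sqrt_iter_real (Suc n) - sqrt_iter_real n"
proof (induction n)
  case 0 then show ?case using assms by simp
next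
  case (Suc n)
  let ?a = "sqrt_iter h (Suc n)" and ?b = "sqrt_iter h n"
  let ?x = "sqrt_iter_real (Suc n)" and ?y = "sqrt_iter_real n"
  have "?a o\<^sub>L ?b = ?b o\<^sub>L ?a"
    by (rule sqrt_iter_commute) (rule sqrt_iter_commute[symmetric], simp)
  then have comm: "blinfun_apply ?a (?b x) = ?b (?a x)" for x by (metis blinfun_apply_blinfun_compose)
  have "sqrt_iter h (Suc (Suc n)) - ?a = (1/2) *\<^sub>R ((?a o\<^sub>L ?a) - (?b o\<^sub>L ?b))"
    by (simp only: sqrt_iter.simps(2)[of h "Suc n"] sqrt_iter.simps(2)[of h n] scaleR_right_diff_distrib[symmetric]) 
       simp
  also have "(?a o\<^sub>L ?a) - (?b o\<^sub>L ?b) = (?a - ?b) o\<^sub>L (?a + ?b)"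
    by (rule blinfun_eqI) (simp only: blinfun_apply_blinfun_compose blinfun.bilinear_simps comm, simp)
  finally have "norm (sqrt_iter h (Suc (Suc n)) - ?a) = (1/2) * norm ((?a - ?b) o\<^sub>L (?a + ?b))"
    by simp
  also have "\<dots> \<le> (1/2) * ((?x - ?y) * (?x + ?y))"
  proof -
    have "norm (?a + ?b) \<le> ?x + ?y"
      by (intro norm_triangle_le add_mono sqrt_iter_norm assms)
    moreover have "0 \<le> ?x - ?y" using norm_ge_zero Suc by (rule order_trans)
    ultimately have "norm (?a - ?b) * norm (?a + ?b) \<le> (?x - ?y) * (?x + ?y)"
      by (intro mult_mono Suc norm_ge_zero)
    then show ?thesis using norm_blinfun_compose[of "?a - ?b" "?a + ?b"] by simp
  qed
  also have "\<dots> = sqrt_iter_real (Suc (Suc n)) - ?x"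
    by (simp only: sqrt_iter_real.simps(2)[of "Suc n"] sqrt_iter_real.simps(2)[of n])
       (simp add: power2_eq_square algebra_simps)
  finally show ?case .
qed

text \<open>The iteration \<open>R \<mapsto> (h + R\<^sup>2) / 2\<close> converges to \<open>1 - \<surd>(1 - h)\<close>, dominated by the same
  iteration for the number \<open>1\<close>.\<close>

lemma operator_square_root:
  fixes h :: "'a::banach \<Rightarrow>\<^sub>L 'a"
  assumes h: "norm h \<le> 1"
  obtains r where "norm r \<le> 1" "2 *\<^sub>R r = h + (r o\<^sub>L r)"
    "\<And>s. h o\<^sub>L s = s o\<^sub>L h \<Longrightarrow> r o\<^sub>L s = s o\<^sub>L r"
proof -
  have mono: "sqrt_iter_real n \<le> sqrt_iter_real (Suc n)" for n
    using order_trans[OF norm_ge_zero sqrt_iter_step[OF h, of n]] by linarith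
  have "convergent sqrt_iter_real"
    by (rule Bseq_monoseq_convergent)
      (use sqrt_iter_real_bounds mono in \<open>auto simp: Bseq_def monoseq_Suc intro!: exI[of _ 1]\<close>)
  then have "summable (\<lambda>n. sqrt_iter_real (Suc n) - sqrt_iter_real n)"
    using telescope_summable[of sqrt_iter_real] by (auto simp: convergent_def)
  then have "summable (\<lambda>n. sqrt_iter h (Suc n) - sqrt_iter h n)"
    by (rule summable_comparison_test'[where N = 0]) (rule sqrt_iter_step[OF h])
  then obtain r where "(\<lambda>n. \<Sum>k<n. sqrt_iter h (Suc k) - sqrt_iter h k) \<longlonglongrightarrow> r"
    by (auto simp: summable_def sums_def)
  then have lim: "sqrt_iter h \<longlonglongrightarrow> r"
    by (simp only: sum_lessThan_telescope) simp
  have "norm r \<le> 1"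
    by (rule LIMSEQ_le_const2[OF tendsto_norm[OF lim]])
      (meson order_trans sqrt_iter_norm[OF h] sqrt_iter_real_bounds(2))
  moreover have "2 *\<^sub>R r = h + (r o\<^sub>L r)"
  proof -
    have "(\<lambda>n. sqrt_iter h (Suc n)) \<longlonglongrightarrow> (1/2) *\<^sub>R (h + (r o\<^sub>L r))"
      unfolding sqrt_iter.simps
      by (intro tendsto_intros bounded_bilinear.tendsto[OF bounded_bilinear_blinfun_compose] lim)
    from LIMSEQ_unique[OF LIMSEQ_Suc[OF lim] this] have "r = (1/2) *\<^sub>R (h + (r o\<^sub>L r))" .
    then have "2 *\<^sub>R r = 2 *\<^sub>R (1/2) *\<^sub>R (h + (r o\<^sub>L r))" by (rule arg_cong)
    then show ?thesis by simp
  qed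
  moreover have "r o\<^sub>L s = s o\<^sub>L r" if "h o\<^sub>L s = s o\<^sub>L h" for s
  proof (rule LIMSEQ_unique)
    show "(\<lambda>n. sqrt_iter h n o\<^sub>L s) \<longlonglongrightarrow> (r o\<^sub>L s)"
      by (intro bounded_bilinear.tendsto[OF bounded_bilinear_blinfun_compose] tendsto_const lim)
    show "(\<lambda>n. sqrt_iter h n o\<^sub>L s) \<longlonglongrightarrow> (s o\<^sub>L r)"
      unfolding sqrt_iter_commute[OF that]
      by (intro bounded_bilinear.tendsto[OF bounded_bilinear_blinfun_compose] tendsto_const lim)
  qed
  ultimately show ?thesis by (rule that)
qed


section \<open>Self-adjoint operators in the commutant of an irreducible representation\<close>

text \<open>Expanding the square leaves
  \<open>- 2 (norm (T \<xi>))^2 + (norm (T (T \<xi>)))^2\<close>, which is not positive for a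
  contraction. This makes \<open>1 - T^2\<close> admissible for
  \<open>operator_square_root\<close>.\<close>

lemma contraction_one_minus_square:
  fixes T :: "'h::complex_hilbert_space \<Rightarrow>\<^sub>L 'h"
  assumes sa: "\<And>\<xi> \<eta>. cinner (T \<xi>) \<eta> = cinner \<xi> (T \<eta>)" and "norm T \<le> 1"
  shows "norm (id_blinfun - (T o\<^sub>L T)) \<le> 1"
proof (rule norm_blinfun_bound)
  fix \<xi>
  have le: "norm (T \<eta>) \<le> norm \<eta>" for \<eta>
    using norm_blinfun[of T \<eta>] mult_right_mono[OF assms(2), of "norm \<eta>"] by simp
  have "(norm (\<xi> - T (T \<xi>)))\<^sup>2 = (norm \<xi>)\<^sup>2 - 2 * (norm (T \<xi>))\<^sup>2 + (norm (T (T \<xi>)))\<^sup>2"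
    by (simp add: norm_diff_squared sa[symmetric] cinner_self)
  also have "\<dots> \<le> (norm \<xi>)\<^sup>2"
    using power_mono[OF le[of "T \<xi>"] norm_ge_zero, of 2] zero_le_power2[of "norm (T \<xi>)"] by linarith
  finally show "norm (blinfun_apply (id_blinfun - (T o\<^sub>L T)) \<xi>) \<le> 1 * norm \<xi>"
    by (simp add: blinfun.bilinear_simps power2_le_iff_abs_le abs_le_square_iff[symmetric])
qed simp

text \<open>With \<open>q = \<surd>(T\<^sup>2)\<close> one has \<open>(q - T) (q + T) = 0\<close>, and the kernel of \<open>q - T\<close> is an invariant
  subspace, so \<open>T = q\<close> or \<open>T = - q\<close>.\<close>

lemma commutant_sign_definite:
  fixes \<pi> :: "'a::unital_cstar_algebra \<Rightarrow> 'h::complex_hilbert_space \<Rightarrow> 'h"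
  assumes irr: "nonzero_irreducible_representation \<pi>"
    and sa: "\<And>\<xi> \<eta>. cinner (blinfun_apply T \<xi>) \<eta> = cinner \<xi> (T \<eta>)"
    and lin: "\<And>c \<xi>. T (c *\<^sub>C \<xi>) = c *\<^sub>C T \<xi>"
    and comm: "\<And>a \<xi>. T (\<pi> a \<xi>) = \<pi> a (T \<xi>)"
    and le1: "norm T \<le> 1"
  shows "(\<forall>\<xi>. 0 \<le> Re (cinner (T \<xi>) \<xi>)) \<or> (\<forall>\<xi>. Re (cinner (T \<xi>) \<xi>) \<le> 0)"
proof -
  let ?h = "id_blinfun - (T o\<^sub>L T)"
  obtain r where r: "norm r \<le> 1" "2 *\<^sub>R r = ?h + (r o\<^sub>L r)"
    and r_comm: "\<And>s. ?h o\<^sub>L s = s o\<^sub>L ?h \<Longrightarrow> r o\<^sub>L s = s o\<^sub>L r"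
    using operator_square_root[OF contraction_one_minus_square[OF sa le1]] by metis
  \<comment> \<open>Whatever commutes with \<open>T\<close> commutes with \<open>1 - T^2\<close>,
    hence with \<open>r\<close>. This is used for \<open>\<pi> a\<close>, for complex scalars and
    for \<open>T\<close> itself.\<close>
  have r_commutes: "blinfun_apply r (blinfun_apply s \<xi>) = s (r \<xi>)"
    if "\<And>\<xi>. blinfun_apply T (blinfun_apply s \<xi>) = s (T \<xi>)" for s \<xi>
  proof -
    have "?h o\<^sub>L s = s o\<^sub>L ?h"
      by (rule blinfun_eqI) (simp add: blinfun.bilinear_simps that)
    then show ?thesis using r_comm by (metis blinfun_apply_blinfun_compose)
  qed
  have \<pi>: "bounded_clinear (\<pi> a)" for a
    using irr by (auto simp: nonzero_irreducible_representation_def representation_def)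
  have r_\<pi>: "r (\<pi> a \<xi>) = \<pi> a (r \<xi>)" for a \<xi>
    using r_commutes[of "Blinfun (\<pi> a)"] \<pi>[of a] comm
    by (simp add: bounded_clinear_def bounded_linear_Blinfun_apply)
  have bl: "bounded_linear ((*\<^sub>C) c :: 'h \<Rightarrow> 'h)" for c
  proof (rule bounded_linear_intro)
    fix x y :: 'h and t :: real
    show "c *\<^sub>C (x + y) = c *\<^sub>C x + c *\<^sub>C y" by (rule scaleC_add_right)
    show "c *\<^sub>C t *\<^sub>R x = t *\<^sub>R c *\<^sub>C x" by (simp add: scaleR_scaleC scaleC_scaleC mult.commute)
    \<comment> \<open>The class of Hilbert spaces states no norm law for complex scalars; it is
      recovered from \<open>cinner_self\<close>.\<close>
    have "(norm (c *\<^sub>C x))\<^sup>2 = (norm x * cmod c)\<^sup>2"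
    proof -
      have "complex_of_real ((norm (c *\<^sub>C x))\<^sup>2) = cinner (c *\<^sub>C x) (c *\<^sub>C x)" by (simp add: cinner_self)
      also have "\<dots> = c * cnj (c * cinner x x)"
        by (metis cinner_commute cinner_scaleC_left)
      also have "\<dots> = complex_of_real ((norm x * cmod c)\<^sup>2)"
        by (simp add: cinner_self power_mult_distrib flip: complex_norm_square)
      finally show ?thesis using of_real_eq_iff by blast
    qed
    then show "norm (c *\<^sub>C x) \<le> norm x * cmod c" by simp
  qed
  have r_lin: "r (c *\<^sub>C \<xi>) = c *\<^sub>C r \<xi>" for c \<xi>
    using r_commutes[of "Blinfun ((*\<^sub>C) c)"] lin by (simp add: bounded_linear_Blinfun_apply bl)
  have r_T: "r (T \<xi>) = T (r \<xi>)" for \<xi>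
    by (rule r_commutes) simp
  define q where "q = id_blinfun - r"
  have q: "blinfun_apply q \<xi> = \<xi> - r \<xi>" for \<xi> by (simp add: q_def blinfun.bilinear_simps)
  have q_pos: "0 \<le> Re (cinner (q \<xi>) \<xi>)" for \<xi>
  proof -
    have "Re (cinner (r \<xi>) \<xi>) \<le> norm (r \<xi>) * norm \<xi>" by (rule Re_cinner_le)
    also have "\<dots> \<le> (1 * norm \<xi>) * norm \<xi>"
      by (intro mult_right_mono order_trans[OF norm_blinfun] r) auto
    finally show ?thesis by (simp add: q cinner_diff_left cinner_self power2_eq_square)
  qed
  \<comment> \<open>\<open>(1 - r)^2 = 1 - 2r + r^2 = 1 - h = T^2\<close>, by the equation that
    \<open>r\<close> satisfies.\<close>
  have q_sq: "q (q \<xi>) = T (T \<xi>)" for \<xi>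
    using arg_cong[OF r(2), of "\<lambda>f. blinfun_apply f \<xi>"]
    by (simp add: q blinfun.bilinear_simps algebra_simps scaleR_2)
  define S where "S = {\<xi>. q \<xi> = T \<xi>}"
  have "closed S"
    unfolding S_def by (intro closed_Collect_eq continuous_intros)
  then have "closed_csubspace S"
    by (simp add: S_def closed_csubspace_def blinfun.bilinear_simps q lin r_lin flip: scaleC_diff_right)
      (simp add: algebra_simps)
  moreover have "\<pi> a \<xi> \<in> S" if "\<xi> \<in> S" for a \<xi>
  proof -
    have "q (\<pi> a \<xi>) = \<pi> a (q \<xi>)"
      using \<pi>[of a] by (simp add: q r_\<pi> bounded_clinear_def linear_diff bounded_linear.linear)
    with that show ?thesis by (simp add: S_def comm)
  qed
  ultimately have "S = {0} \<or> S = UNIV"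
    using irr by (simp add: nonzero_irreducible_representation_def)
  then show ?thesis
  proof
    assume "S = UNIV"
    then have "q \<xi> = T \<xi>" for \<xi> by (auto simp: S_def)
    with q_pos show ?thesis by metis
  next
    assume S: "S = {0}"
    have "q \<xi> + T \<xi> \<in> S" for \<xi>
      by (simp add: S_def blinfun.bilinear_simps q_sq[symmetric]) (simp add: q blinfun.bilinear_simps r_T)
    with S have "T \<xi> = - q \<xi>" for \<xi>
      by (metis add.commute add_eq_0_iff singletonD)
    with q_pos show ?thesis by (simp add: cinner_minus_left)
  qed
qed

text \<open>Sign definiteness of every \<open>T - t\<close> makes the lower bounds \<open>t\<close>
  of the quadratic form a cut. At its supremum \<open>t0\<close> the form of \<open>T - t0\<close>
  vanishes, and a symmetric operator with zero quadratic form is zero.\<close>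

lemma selfadjoint_commutant_scalar:
  fixes \<pi> :: "'a::unital_cstar_algebra \<Rightarrow> 'h::complex_hilbert_space \<Rightarrow> 'h"
  assumes irr: "nonzero_irreducible_representation \<pi>"
    and sa: "\<And>\<xi> \<eta>. cinner (blinfun_apply T \<xi>) \<eta> = cinner \<xi> (T \<eta>)"
    and lin: "\<And>c \<xi>. T (c *\<^sub>C \<xi>) = c *\<^sub>C T \<xi>"
    and comm: "\<And>a \<xi>. T (\<pi> a \<xi>) = \<pi> a (T \<xi>)"
  obtains t :: real where "\<And>\<xi>. T \<xi> = t *\<^sub>R \<xi>"
proof -
  have \<pi>: "bounded_clinear (\<pi> a)" for a
    using irr by (auto simp: nonzero_irreducible_representation_def representation_def)
  have definite: "(\<forall>\<xi>. t * (norm \<xi>)\<^sup>2 \<le> Re (cinner (T \<xi>) \<xi>)) \<or> (\<forall>\<xi>. Re (cinner (T \<xi>) \<xi>) \<le> t * (norm \<xi>)\<^sup>2)"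
    for t
  proof -
    let ?D = "T - t *\<^sub>R id_blinfun"
    \<comment> \<open>Rescales \<open>T - t\<close> into the unit ball, as
      \<open>commutant_sign_definite\<close> demands; the summand 1 keeps the inverse positive even
      if \<open>T = t\<close>.\<close>
    define m where "m = inverse (1 + norm ?D)"
    have m: "0 < m" unfolding m_def by (smt (verit) norm_ge_zero positive_imp_inverse_positive)
    have "norm (m *\<^sub>R ?D) = norm ?D / (1 + norm ?D)"
      using m by (simp add: m_def divide_inverse_commute)
    also have "\<dots> \<le> 1"
      by (smt (verit) norm_ge_zero divide_le_eq_1)
    finally have n: "norm (m *\<^sub>R ?D) \<le> 1" .
    have app: "blinfun_apply (m *\<^sub>R ?D) \<xi> = m *\<^sub>R (T \<xi> - t *\<^sub>R \<xi>)" for \<xi>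
      by (simp add: blinfun.bilinear_simps)
    have sa': "cinner (blinfun_apply (m *\<^sub>R ?D) \<xi>) \<eta> = cinner \<xi> (blinfun_apply (m *\<^sub>R ?D) \<eta>)" for \<xi> \<eta>
      unfolding app
      by (simp add: cinner_scaleR_left cinner_scaleR_right cinner_diff_left cinner_diff_right sa)
    have lin': "blinfun_apply (m *\<^sub>R ?D) (c *\<^sub>C \<xi>) = c *\<^sub>C blinfun_apply (m *\<^sub>R ?D) \<xi>" for c \<xi>
      unfolding app by (simp add: lin scaleR_scaleC scaleC_scaleC scaleC_diff_right mult_ac)
    have comm': "blinfun_apply (m *\<^sub>R ?D) (\<pi> a \<xi>) = \<pi> a (blinfun_apply (m *\<^sub>R ?D) \<xi>)" for a \<xi>
      using \<pi>[of a] unfolding app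
      by (auto simp: bounded_clinear_def linear_diff bounded_linear.linear linear_cmul comm)
    have "Re (cinner (blinfun_apply (m *\<^sub>R ?D) \<xi>) \<xi>) = m * (Re (cinner (T \<xi>) \<xi>) - t * (norm \<xi>)\<^sup>2)" for \<xi>
      unfolding app by (simp add: cinner_scaleR_left cinner_diff_left cinner_self)
    with commutant_sign_definite[OF irr sa' lin' comm' n] m show ?thesis
      by (auto simp: zero_le_mult_iff mult_le_0_iff)
  qed
  obtain \<xi>0 :: 'h where \<xi>0: "\<xi>0 \<noteq> 0"
    using irr by (auto simp: nonzero_irreducible_representation_def)
  define P where "P = {t. \<forall>\<xi>. t * (norm \<xi>)\<^sup>2 \<le> Re (cinner (T \<xi>) \<xi>)}"
  have bound: "\<bar>Re (cinner (T \<xi>) \<xi>)\<bar> \<le> norm T * (norm \<xi>)\<^sup>2" for \<xi>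
  proof -
    have "norm (T \<xi>) * norm \<xi> \<le> norm T * (norm \<xi>)\<^sup>2"
      using mult_right_mono[OF norm_blinfun[of T \<xi>] norm_ge_zero[of \<xi>]] by (simp add: power2_eq_square mult_ac)
    moreover have "Re (cinner (T \<xi>) \<xi>) \<le> norm (T \<xi>) * norm \<xi>" by (rule Re_cinner_le)
    moreover have "- Re (cinner (T \<xi>) \<xi>) \<le> norm (T \<xi>) * norm \<xi>"
      using Re_cinner_le[of "- T \<xi>" \<xi>] by (simp add: cinner_minus_left)
    ultimately show ?thesis by linarith
  qed
  have "- norm T \<in> P" unfolding P_def using bound by (auto simp: abs_le_iff minus_le_iff)
  moreover have bdd: "bdd_above P"
  proof (rule bdd_aboveI)
    fix t assume "t \<in> P"
    then have "t * (norm \<xi>0)\<^sup>2 \<le> norm T * (norm \<xi>0)\<^sup>2"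
      unfolding P_def using bound[of \<xi>0] by (auto simp: abs_le_iff intro: order_trans)
    then show "t \<le> norm T" using \<xi>0 by simp
  qed
  moreover have "closed P"
  proof -
    have "P = (\<Inter>\<xi>. {t. t * (norm \<xi>)\<^sup>2 \<le> Re (cinner (T \<xi>) \<xi>)})" by (auto simp: P_def)
    then show ?thesis by (auto intro!: closed_INT closed_Collect_le continuous_intros)
  qed
  ultimately have "Sup P \<in> P" by (intro closed_contains_Sup) auto
  define t0 where "t0 = Sup P"
  have lower: "t0 * (norm \<xi>)\<^sup>2 \<le> Re (cinner (T \<xi>) \<xi>)" for \<xi>
    using \<open>Sup P \<in> P\<close> by (auto simp: P_def t0_def)
  have upper: "Re (cinner (T \<xi>) \<xi>) \<le> t0 * (norm \<xi>)\<^sup>2" for \<xi>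
  proof -
    \<comment> \<open>Just above the supremum \<open>t\<close> is no longer a lower bound, so
      \<open>definite\<close> yields the upper inequality there.\<close>
    have "Re (cinner (T \<xi>) \<xi>) \<le> (t0 + inverse (real (Suc n))) * (norm \<xi>)\<^sup>2" for n
    proof -
      have "t0 + inverse (real (Suc n)) \<notin> P"
        using cSup_upper[OF _ bdd] unfolding t0_def[symmetric] by fastforce
      then show ?thesis using definite unfolding P_def by blast
    qed
    moreover have "(\<lambda>n. (t0 + inverse (real (Suc n))) * (norm \<xi>)\<^sup>2) \<longlonglongrightarrow> (t0 + 0) * (norm \<xi>)\<^sup>2"
      by (intro tendsto_intros LIMSEQ_inverse_real_of_nat)
    ultimately show ?thesis by (intro LIMSEQ_le_const) auto
  qed
  define S where "S \<xi> = T \<xi> - t0 *\<^sub>R \<xi>" for \<xi>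
  have S0: "Re (cinner (S \<xi>) \<xi>) = 0" for \<xi>
    using lower[of \<xi>] upper[of \<xi>] by (simp add: S_def cinner_diff_left cinner_scaleR_left cinner_self)
  have S_add: "S (\<xi> + \<eta>) = S \<xi> + S \<eta>" for \<xi> \<eta>
    by (simp add: S_def blinfun.bilinear_simps scaleR_add_right)
  have S_sym: "Re (cinner (S \<xi>) \<eta>) = Re (cinner (S \<eta>) \<xi>)" for \<xi> \<eta>
    using Re_cinner_commute[of \<xi> \<eta>] Re_cinner_commute[of \<xi> "T \<eta>"]
    by (simp add: S_def cinner_diff_left cinner_scaleR_left sa)
  have "S \<xi> = 0" for \<xi>
  proof -
    \<comment> \<open>Polarization: by symmetry both mixed terms equal
      \<open>(norm (S \<xi>))^2\<close>, and all other terms vanish.\<close>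
    have "Re (cinner (S (\<xi> + S \<xi>)) (\<xi> + S \<xi>))
        = Re (cinner (S \<xi>) \<xi>) + Re (cinner (S \<xi>) (S \<xi>)) + Re (cinner (S (S \<xi>)) \<xi>) + Re (cinner (S (S \<xi>)) (S \<xi>))"
      by (simp add: S_add cinner_add_left cinner_add_right)
    then have "Re (cinner (S \<xi>) (S \<xi>)) = 0"
      using S_sym[of "S \<xi>" \<xi>] by (simp add: S0)
    then show ?thesis by (simp add: cinner_self)
  qed
  then show ?thesis by (intro that[of t0]) (simp add: S_def)
qed

text \<open>A central self-adjoint element acts in the commutant, hence as a real scalar, and
  faithfulness carries this back to the algebra. The self-adjoint elements \<open>z + star z\<close>
  and \<open>\<i> *\<^sub>C (z - star z)\<close> then recover \<open>z\<close>.\<close>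

theorem primitive_center_trivial:
  assumes "primitive_cstar_on TYPE('a::unital_cstar_algebra) TYPE('h::complex_hilbert_space)"
    and central: "\<And>w::'a. z * w = w * z"
  obtains c where "z = c *\<^sub>C (1::'a)"
proof -
  obtain \<pi> :: "'a \<Rightarrow> 'h \<Rightarrow> 'h" where irr: "nonzero_irreducible_representation \<pi>" and inj: "inj \<pi>"
    using assms(1) by (auto simp: primitive_cstar_on_def)
  have bl: "bounded_linear (\<pi> a)" and lin: "\<pi> a (c *\<^sub>C \<xi>) = c *\<^sub>C \<pi> a \<xi>"
    and scale: "\<pi> (c *\<^sub>C a) \<xi> = c *\<^sub>C \<pi> a \<xi>"
    and mult: "\<pi> (a * b) \<xi> = \<pi> a (\<pi> b \<xi>)"
    and adj: "cinner (\<pi> a \<xi>) \<eta> = cinner \<xi> (\<pi> (star a) \<eta>)" for a b c \<xi> \<eta>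
    using irr by (auto simp: nonzero_irreducible_representation_def representation_def bounded_clinear_def)
  have one: "\<pi> 1 \<xi> = \<xi>" for \<xi>
  proof -
    \<comment> \<open>\<open>representation\<close> does not demand \<open>\<pi> 1\<close> to be the
      identity. Its fixed space is invariant and contains the non-zero range of
      \<open>\<pi>\<close>, so irreducibility makes it everything.\<close>
    define S where "S = {\<xi>. \<pi> 1 \<xi> = \<xi>}"
    have "closed S"
      unfolding S_def by (intro closed_Collect_eq continuous_intros linear_continuous_on bl)
    then have "S = {0} \<or> S = UNIV"
      using irr unfolding nonzero_irreducible_representation_def
      by (elim conjE allE[of _ S] impE)
        (auto simp: S_def closed_csubspace_def linear_0 linear_add bounded_linear.linear[OF bl] lin
          simp flip: mult)
    moreover obtain a \<xi> where "\<pi> a \<xi> \<noteq> 0"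
      using irr by (auto simp: nonzero_irreducible_representation_def)
    moreover have "\<pi> a \<xi> \<in> S" for a \<xi> by (simp add: S_def flip: mult)
    ultimately show ?thesis by (auto simp: S_def)
  qed
  have sa_scalar: "\<exists>t::real. h = t *\<^sub>R 1" if "star h = h" and c: "\<And>w. h * w = w * h" for h :: 'a
  proof -
    have h: "blinfun_apply (Blinfun (\<pi> h)) = \<pi> h" by (simp add: bounded_linear_Blinfun_apply bl)
    have "\<pi> h (\<pi> a \<xi>) = \<pi> a (\<pi> h \<xi>)" for a \<xi>
      by (simp add: c flip: mult)
    moreover have "cinner (\<pi> h \<xi>) \<eta> = cinner \<xi> (\<pi> h \<eta>)" for \<xi> \<eta>
      using adj[of h \<xi> \<eta>] that(1) by simp
    ultimately obtain t :: real where "\<And>\<xi>. \<pi> h \<xi> = t *\<^sub>R \<xi>"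
      using selfadjoint_commutant_scalar[OF irr, of "Blinfun (\<pi> h)"] lin unfolding h by blast
    then have "\<pi> h = \<pi> (t *\<^sub>R 1)" by (auto simp: scaleR_scaleC scale one)
    then show ?thesis using inj by (auto dest: injD)
  qed
  have central_star: "star z * w = w * star z" for w
    using arg_cong[OF central[of "star w"], of star] by (simp add: star_mult star_star)
  obtain s where s: "z + star z = s *\<^sub>R 1"
    using sa_scalar[of "z + star z"]
    by (auto simp: star_add star_star add.commute distrib_left distrib_right central central_star)
  have "star (\<i> *\<^sub>C (z - star z)) = (- \<i>) *\<^sub>C (star z - z)"
    by (simp add: star_scaleC star_diff star_star)
  also have "\<dots> = ((- \<i>) * (- 1)) *\<^sub>C (z - star z)"
    unfolding scaleC_scaleC[symmetric] using scaleR_scaleC[of "- 1" "z - star z"] by simp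
  finally have "star (\<i> *\<^sub>C (z - star z)) = \<i> *\<^sub>C (z - star z)" by simp
  then obtain t where t: "\<i> *\<^sub>C (z - star z) = t *\<^sub>R 1"
    using sa_scalar[of "\<i> *\<^sub>C (z - star z)"]
    by (auto simp: mult_scaleC_left mult_scaleC_right left_diff_distrib right_diff_distrib central central_star)
  have "2 *\<^sub>R z = (z + star z) + (- \<i>) *\<^sub>C (\<i> *\<^sub>C (z - star z))"
    by (simp add: scaleC_scaleC scaleC_one scaleR_2)
  also have "\<dots> = (complex_of_real s - \<i> * t) *\<^sub>C 1"
    by (simp add: s t scaleR_scaleC scaleC_scaleC scaleC_add_left[symmetric])
  finally have "(1/2) *\<^sub>R 2 *\<^sub>R z = (1/2) *\<^sub>R (complex_of_real s - \<i> * t) *\<^sub>C 1" by (rule arg_cong)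
  then have "z = (complex_of_real (1/2) * (complex_of_real s - \<i> * t)) *\<^sub>C 1"
    by (simp only: scaleR_scaleC[of "1/2" "_ *\<^sub>C _"] scaleC_scaleC) simp
  then show ?thesis by (rule that)
qed

section \<open>Completeness and the bounded inverse theorem\<close>

lemmas lip_rep_eqs = zero_lip.rep_eq plus_lip.rep_eq minus_lip.rep_eq uminus_lip.rep_eq
  times_lip.rep_eq scaleC_lip.rep_eq scaleR_lip.rep_eq star_lip.rep_eq

lemma SUP_norm_nonneg: "0 \<le> (SUP x. norm (lip_apply F x))"
  using norm_ge_zero norm_lip_apply_le_SUP by (rule order_trans)

lemma norm_lip_apply_le: "norm (lip_apply F x) \<le> norm F"
  using norm_lip_apply_le_SUP[of F x] lip_seminorm_apply_nonneg[of F] by (simp add: norm_lip_def)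

lemma norm_lip_apply_diff_le: "norm (lip_apply F x - lip_apply F y) \<le> norm F * dist x y"
  using lip_apply_bound[of F x y] mult_right_mono[of "lip_seminorm (lip_apply F)" "norm F" "dist x y"]
    SUP_norm_nonneg[of F] by (simp add: norm_lip_def)

lemma norm_lip_le:
  assumes "\<And>x. norm (lip_apply F x) \<le> a"
    and "\<And>x y. norm (lip_apply F x - lip_apply F y) \<le> b * dist x y" and "0 \<le> b"
  shows "norm F \<le> a + b"
  unfolding norm_lip_def
  by (intro add_mono cSUP_least lip_quotients_bound(2) assms) auto

lemma lip_apply_Lip:
  assumes "\<And>x y. norm (f x - f y) \<le> K * dist x y"
  shows "lip_apply (Lip f) = f"
  by (rule Lip_inverse) (simp add: lip_quotients_bound(1)[OF assms])

text \<open>Completeness of the Lipschitz norm makes \<open>bounded_inverse\<close> applicable to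
  \<open>J\<close>. Bounds on \<open>X m - X n\<close> at a point and at a pair of points survive
  \<open>n \<rightarrow> \<infinity>\<close> with \<open>m\<close> fixed, which controls both parts
  of the norm against the pointwise limit.\<close>

instance lip :: (compact_metric_space, unital_cstar_algebra) banach
proof
  fix X :: "nat \<Rightarrow> ('a, 'b) lip"
  assume X: "Cauchy X"
  have "convergent (\<lambda>n. lip_apply (X n) x)" for x
  proof (rule Cauchy_convergent, rule metric_CauchyI)
    fix e :: real assume "0 < e"
    then obtain N where "\<forall>m\<ge>N. \<forall>n\<ge>N. dist (X m) (X n) < e"
      using X by (auto simp: Cauchy_def)
    then have "dist (lip_apply (X m) x) (lip_apply (X n) x) < e" if "m \<ge> N" "n \<ge> N" for m n
      using that norm_lip_apply_le[of "X m - X n" x]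
      by (force simp: dist_norm lip_rep_eqs)
    then show "\<exists>N. \<forall>m\<ge>N. \<forall>n\<ge>N. dist (lip_apply (X m) x) (lip_apply (X n) x) < e" by blast
  qed
  then obtain f where f: "(\<lambda>n. lip_apply (X n) x) \<longlonglongrightarrow> f x" for x
    unfolding convergent_def by metis
  have near: "norm (lip_apply (X m) x - f x) \<le> e"
      "norm ((lip_apply (X m) x - f x) - (lip_apply (X m) y - f y)) \<le> e * dist x y"
    if "\<And>n. n \<ge> N \<Longrightarrow> norm (X m - X n) \<le> e" for m N e x y
  proof -
    have "norm (lip_apply (X m) x - lip_apply (X n) x) \<le> e" if "n \<ge> N" for n
      using norm_lip_apply_le[of "X m - X n" x] \<open>\<And>n. n \<ge> N \<Longrightarrow> norm (X m - X n) \<le> e\<close>[OF that]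
      by (simp add: lip_rep_eqs)
    then show "norm (lip_apply (X m) x - f x) \<le> e"
      by (intro LIMSEQ_le_const2[OF tendsto_norm[OF tendsto_diff[OF tendsto_const f]]]) auto
    have "norm ((lip_apply (X m) x - lip_apply (X n) x) - (lip_apply (X m) y - lip_apply (X n) y)) \<le> e * dist x y"
      if "n \<ge> N" for n
      using norm_lip_apply_diff_le[of "X m - X n" x y]
        mult_right_mono[OF \<open>\<And>n. n \<ge> N \<Longrightarrow> norm (X m - X n) \<le> e\<close>[OF that], of "dist x y"]
      by (simp add: lip_rep_eqs)
    moreover have "(\<lambda>n. norm ((lip_apply (X m) x - lip_apply (X n) x) - (lip_apply (X m) y - lip_apply (X n) y)))
        \<longlonglongrightarrow> norm ((lip_apply (X m) x - f x) - (lip_apply (X m) y - f y))"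
      by (intro tendsto_intros f)
    ultimately show "norm ((lip_apply (X m) x - f x) - (lip_apply (X m) y - f y)) \<le> e * dist x y"
      by (intro LIMSEQ_le_const2) auto
  qed
  have Cauchy: "\<exists>N. \<forall>m\<ge>N. \<forall>n\<ge>N. norm (X m - X n) \<le> e" if "0 < e" for e
    using metric_CauchyD[OF X that] unfolding dist_norm by (meson less_imp_le)
  then obtain N where N: "\<forall>m\<ge>N. \<forall>n\<ge>N. norm (X m - X n) \<le> 1" using zero_less_one by blast
  have f_Lip: "lip_apply (Lip f) = f"
  proof (rule lip_apply_Lip)
    fix x y
    have "norm ((lip_apply (X N) x - f x) - (lip_apply (X N) y - f y)) \<le> 1 * dist x y"
      using N by (intro near(2)[of N]) auto
    moreover have "f x - f y = (lip_apply (X N) x - lip_apply (X N) y)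
        - ((lip_apply (X N) x - f x) - (lip_apply (X N) y - f y))" by simp
    ultimately show "norm (f x - f y) \<le> (norm (X N) + 1) * dist x y"
      using norm_triangle_ineq4[of "lip_apply (X N) x - lip_apply (X N) y"
          "(lip_apply (X N) x - f x) - (lip_apply (X N) y - f y)"]
        norm_lip_apply_diff_le[of "X N" x y]
      by (simp add: distrib_right)
  qed
  have "X \<longlonglongrightarrow> Lip f"
  proof (rule metric_LIMSEQ_I)
    fix e :: real assume e: "0 < e"
    obtain N where N: "\<forall>m\<ge>N. \<forall>n\<ge>N. norm (X m - X n) \<le> e / 3"
      using Cauchy[of "e / 3"] e by auto
    have "norm (X m - Lip f) \<le> e / 3 + e / 3" if "m \<ge> N" for m
      using N that e near[of N m "e / 3"] by (intro norm_lip_le) (auto simp: lip_rep_eqs f_Lip)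
    then show "\<exists>N. \<forall>m\<ge>N. dist (X m) (Lip f) < e"
      using e by (force simp: dist_norm)
  qed
  then show "convergent X" by (rule convergentI)
qed

lemma bounded_linear_of_continuous:
  fixes f :: "'a::real_normed_vector \<Rightarrow> 'b::real_normed_vector"
  assumes "linear f" and "continuous_on UNIV f"
  shows "bounded_linear f"
proof -
  have "isCont f 0" using assms(2) by (simp add: continuous_on_eq_continuous_at)
  then obtain d where d: "0 < d" "\<And>x. norm x < d \<Longrightarrow> norm (f x) < 1"
    using linear_0[OF assms(1)] by (auto simp: continuous_at_eps_delta dist_norm dest!: spec[of _ 1])
  have "norm (f x) \<le> norm x * (2 / d)" for x
  proof (cases "x = 0")
    case False
    let ?c = "d / (2 * norm x)"
    have "norm (f (?c *\<^sub>R x)) < 1" using False d(1) by (intro d(2)) simp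
    then have "?c * norm (f x) < 1" using d(1) by (simp add: linear_cmul[OF assms(1)])
    then show ?thesis using False d(1) by (simp add: field_simps)
  qed (simp add: linear_0[OF assms(1)])
  then show ?thesis
    using assms(1) by (intro bounded_linear_intro[of f "2 / d"]) (auto simp: linear_add linear_cmul)
qed

text \<open>By Baire some closed image of a ball contains a ball around a point \<open>b\<close>.
  Subtracting approximate preimages of \<open>b + s y\<close> and of \<open>b\<close> removes the
  unknown centre.\<close>

lemma approximate_preimages:
  fixes f :: "'a::banach \<Rightarrow> 'b::banach"
  assumes f: "bounded_linear f" and surj: "surj f"
  obtains M where "0 < M" "\<And>y. \<exists>x. norm x \<le> M * norm y \<and> norm (y - f x) \<le> norm y / 2"
proof -
  interpret f: bounded_linear f by fact
  have "\<exists>n. interior (closure (f ` cball 0 (real n))) \<noteq> {}"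
  proof (rule ccontr)
    assume empty: "\<not> ?thesis"
    have "Met_TC.mtopology interior_of \<Union>(range (\<lambda>n. closure (f ` cball 0 (real n)))) = {}"
      by (rule Met_TC.metric_Baire_category_alt) (use empty complete_UNIV[where 'a = 'b] in auto)
    then have "interior (\<Union>(range (\<lambda>n. closure (f ` cball 0 (real n))))) = {}" by simp
    moreover have "y \<in> (\<Union>(range (\<lambda>n. closure (f ` cball 0 (real n)))))" for y
    proof -
      obtain x where "y = f x" using surj by blast
      moreover obtain n where "norm x \<le> real n" using real_arch_simple by blast
      ultimately have "y \<in> closure (f ` cball 0 (real n))" by (intro subsetD[OF closure_subset]) auto
      then show ?thesis by blast
    qed
    ultimately show False by (metis UNIV_I UNIV_eq_I empty_iff interior_UNIV)
  qed
  then obtain n b r where r: "0 < r" and br: "ball b r \<subseteq> closure (f ` cball 0 (real n))"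
    by (meson equals0I mem_interior)
  have approx: "\<exists>x. norm x \<le> n \<and> norm (y - f x) < e" if "y \<in> ball b r" "0 < e" for y e
    using subsetD[OF br that(1)] that(2)
    by (force simp: closure_approachable dist_norm norm_minus_commute)
  define M where "M = 4 * (real n + 1) / r"
  have "\<exists>x. norm x \<le> M * norm y \<and> norm (y - f x) \<le> norm y / 2" for y
  proof (cases "y = 0")
    case True then show ?thesis by (intro exI[of _ 0]) (simp add: f.zero)
  next
    case False
    \<comment> \<open>\<open>b + s y\<close> then has distance \<open>r / 2\<close> from
      \<open>b\<close>. Two errors of \<open>r / 8\<close> give \<open>r / 4\<close>, which divided
      by \<open>s\<close> is \<open>norm y / 2\<close>; likewise
      \<open>2 n / s = 4 n norm y / r\<close> explains \<open>M\<close>.\<close>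
    define s where "s = r / (2 * norm y)"
    have s: "0 < s" "s * norm y = r / 2" using False r by (auto simp: s_def)
    obtain u where u: "norm u \<le> n" "norm (b + s *\<^sub>R y - f u) < r / 8"
      using approx[of "b + s *\<^sub>R y" "r / 8"] s r by (auto simp: dist_norm)
    obtain v where v: "norm v \<le> n" "norm (b - f v) < r / 8"
      using approx[of b "r / 8"] r by auto
    let ?x = "(1 / s) *\<^sub>R (u - v)"
    have "norm (s *\<^sub>R y - f (u - v)) \<le> r / 4"
      using norm_triangle_ineq4[of "b + s *\<^sub>R y - f u" "b - f v"] u(2) v(2) by (simp add: f.diff algebra_simps)
    moreover have "y - f ?x = (1 / s) *\<^sub>R (s *\<^sub>R y - f (u - v))"
      using s(1) by (simp add: f.scaleR f.diff scaleR_diff_right)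
    then have "norm (y - f ?x) = norm (s *\<^sub>R y - f (u - v)) / s" using s(1) by simp
    ultimately have "norm (y - f ?x) \<le> (r / 4) / s"
      using s(1) by (simp only: divide_right_mono less_imp_le)
    also have "\<dots> = norm y / 2" using s by (simp add: field_simps)
    finally have "norm (y - f ?x) \<le> norm y / 2" .
    moreover have "norm ?x \<le> M * norm y"
    proof -
      have "norm ?x \<le> (2 * n) / s"
        using norm_triangle_ineq4[of u v] u(1) v(1) s(1) by (simp add: divide_right_mono)
      also have "\<dots> \<le> 4 * (real n + 1) / r * norm y" 
        using False r by (simp add: s_def field_simps)
      finally show ?thesis by (simp add: M_def)
    qed
    ultimately show ?thesis by blast
  qed
  then show ?thesis using r by (intro that[of M]) (auto simp: M_def)
qed

text \<open>The residual \<open>y - f (g y)\<close> has at most half the norm of \<open>y\<close>.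
  Correcting residuals repeatedly gives a series for the preimage, dominated by a geometric series
  with sum \<open>2 M norm y\<close>.\<close>

theorem bounded_inverse:
  fixes f :: "'a::banach \<Rightarrow> 'b::banach"
  assumes f: "bounded_linear f" and bij: "bij f"
  shows "bounded_linear (inv f)"
proof -
  interpret f: bounded_linear f by fact
  obtain M where M: "0 < M" and "\<And>y. \<exists>x. norm x \<le> M * norm y \<and> norm (y - f x) \<le> norm y / 2"
    using approximate_preimages[OF f bij_is_surj[OF bij]] by blast
  then obtain g where g: "\<And>y. norm (g y) \<le> M * norm y" "\<And>y. norm (y - f (g y)) \<le> norm y / 2"
    by metis
  have bound: "norm (inv f y) \<le> norm y * (2 * M)" for y
  proof -
    define Y where "Y n = ((\<lambda>z. z - f (g z)) ^^ n) y" for n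
    have Y_Suc: "Y (Suc n) = Y n - f (g (Y n))" for n by (simp add: Y_def)
    have Y: "norm (Y n) \<le> norm y * (1 / 2) ^ n" for n
    proof (induction n)
      case (Suc n)
      then show ?case using g(2)[of "Y n"] by (simp add: Y_Suc)
    qed (simp add: Y_def)
    have gY: "norm (g (Y n)) \<le> M * norm y * (1 / 2) ^ n" for n
      using order_trans[OF g(1)[of "Y n"] mult_left_mono[OF Y[of n] less_imp_le[OF M]]]
      by (simp only: mult.assoc)
    have sums: "(\<lambda>n. M * norm y * (1 / 2) ^ n) sums (M * norm y * (1 / (1 - 1 / 2)))"
      by (intro sums_mult geometric_sums) simp
    have summ: "summable (\<lambda>n. g (Y n))"
      by (rule summable_comparison_test'[OF sums_summable[OF sums], of 0]) (rule gY)
    define x where "x = (\<Sum>n. g (Y n))"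
    have "norm x \<le> M * norm y * (1 / (1 - 1 / 2))"
      unfolding x_def sums_unique[OF sums]
      by (rule norm_suminf_le[OF gY sums_summable[OF sums]])
    moreover have "f x = y"
    proof -
      have "(\<lambda>n. f (g (Y n))) sums f x"
        unfolding x_def by (intro f.sums summable_sums summ)
      moreover have "(\<lambda>n. f (g (Y n))) sums (Y 0 - 0)"
      proof -
        have "Y \<longlonglongrightarrow> 0"
        proof (rule Lim_null_comparison)
          show "\<forall>\<^sub>F n in sequentially. norm (Y n) \<le> norm y * (1 / 2) ^ n" using Y by simp
          show "(\<lambda>n. norm y * (1 / 2) ^ n) \<longlonglongrightarrow> 0"
            by (intro tendsto_mult_right_zero LIMSEQ_power_zero) simp
        qed
        from telescope_sums'[OF this] show ?thesis by (simp add: Y_Suc)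
      qed
      ultimately have "f x = Y 0 - 0" by (rule sums_unique2)
      then show ?thesis by (simp add: Y_def)
    qed
    then have "inv f y = x" using bij by (auto simp: bij_is_inj inv_f_eq)
    ultimately show ?thesis by (simp add: mult_ac)
  qed
  have inv: "f (inv f y) = y" for y using bij by (simp add: bij_is_surj surj_f_inv_f)
  have inv_eq: "inv f y = x \<longleftrightarrow> y = f x" for x y
    using bij by (auto simp: inv bij_is_inj)
  show ?thesis
    by (rule bounded_linear_intro[OF _ _ bound]) (simp_all add: inv_eq f.add f.scaleR inv)
qed

section \<open>Characters of the scalar Lipschitz functions\<close>

definition lip_const :: "'a::unital_cstar_algebra \<Rightarrow> ('x::compact_metric_space, 'a) lip" where
  "lip_const a = Lip (\<lambda>_. a)"

lemma lip_apply_const [simp]: "lip_apply (lip_const a) x = a"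
  unfolding lip_const_def by (subst lip_apply_Lip[where K = 0]) auto

lemma norm_lip_const_le: "norm (lip_const a) \<le> norm a"
  using norm_lip_le[of "lip_const a" "norm a" 0] by simp

abbreviation lipschitz_fun :: "('x::metric_space \<Rightarrow> 'a::real_normed_vector) \<Rightarrow> bool" where
  "lipschitz_fun f \<equiv> bdd_above (lip_quotients f)"

definition lip_scalar :: "('x::compact_metric_space \<Rightarrow> real) \<Rightarrow> ('x, 'a::unital_cstar_algebra) lip" where
  "lip_scalar f = Lip (\<lambda>x. f x *\<^sub>R 1)"

lemma lip_apply_scalar [simp]: "lipschitz_fun f \<Longrightarrow> lip_apply (lip_scalar f) x = f x *\<^sub>R 1"
  unfolding lip_scalar_def
  by (subst lip_apply_Lip[where K = "lip_seminorm f"])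
    (simp_all add: lip_seminorm_bound[of f, simplified] flip: scaleR_diff_left)

lemma lipschitz_fun_const [simp]: "lipschitz_fun (\<lambda>_. c)"
  by (rule lip_quotients_bound(1)[where K = 0]) simp

lemma lipschitz_fun_dist [simp]: "lipschitz_fun (\<lambda>x. dist x p)"
  by (rule lip_quotients_bound(1)[where K = 1])
    (simp, metis abs_dist_diff_le dist_commute)

lemma lipschitz_fun_diff:
  "lipschitz_fun f \<Longrightarrow> lipschitz_fun g \<Longrightarrow> lipschitz_fun (\<lambda>x. f x - g x)"
  using bdd_lip_quotients_add(1)[of f "\<lambda>x. - g x"] by (simp add: bdd_lip_quotients_minus)

lemma lipschitz_fun_sum:
  "finite T \<Longrightarrow> (\<And>i. i \<in> T \<Longrightarrow> lipschitz_fun (g i)) \<Longrightarrow> lipschitz_fun (\<lambda>x. \<Sum>i\<in>T. g i x)"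
  by (induction T rule: finite_induct) (auto intro: bdd_lip_quotients_add(1))

lemma lipschitz_fun_continuous:
  assumes "lipschitz_fun f"
  shows "continuous_on UNIV f"
proof (rule lipschitz_on_continuous_on)
  show "(lip_seminorm f)-lipschitz_on UNIV f"
    using lip_seminorm_bound[OF assms] lip_seminorm_nonneg[OF assms]
    by (auto simp: lipschitz_on_def dist_norm)
qed

lemma lipschitz_fun_inverse:
  fixes f :: "'x::metric_space \<Rightarrow> real"
  assumes f: "lipschitz_fun f" and d: "0 < d" "\<And>x. d \<le> f x"
  shows "lipschitz_fun (\<lambda>x. inverse (f x))"
proof (rule lip_quotients_bound(1))
  fix x y
  have pos: "0 < f x" "0 < f y" using d(1) d(2)[of x] d(2)[of y] by linarith+
  have "norm (inverse (f x) - inverse (f y)) = norm (f x - f y) / (f x * f y)"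
    using pos by (simp add: field_simps abs_mult abs_minus_commute)
  also have "\<dots> \<le> (lip_seminorm f * dist x y) / (d * d)"
    using pos d by (intro frac_le mult_mono lip_seminorm_bound[OF f] mult_nonneg_nonneg
        lip_seminorm_nonneg[OF f]) auto
  finally show "norm (inverse (f x) - inverse (f y)) \<le> (lip_seminorm f / (d * d)) * dist x y" by simp
qed

text \<open>If \<open>ev\<close> were no evaluation, each \<open>x\<close> would have a square
  \<open>(f - ev f)^2\<close> killed by \<open>ev\<close> but positive at \<open>x\<close>.
  Compactness makes a finite sum of these squares positive everywhere, hence invertible among
  Lipschitz functions, although \<open>ev\<close> kills it.\<close>

lemma lipschitz_character_evaluation:
  fixes ev :: "('x::compact_metric_space \<Rightarrow> real) \<Rightarrow> real"
  assumes add: "\<And>f g. lipschitz_fun f \<Longrightarrow> lipschitz_fun g \<Longrightarrow> ev (\<lambda>x. f x + g x) = ev f + ev g"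
    and mult: "\<And>f g. lipschitz_fun f \<Longrightarrow> lipschitz_fun g \<Longrightarrow> ev (\<lambda>x. f x * g x) = ev f * ev g"
    and const: "\<And>c. ev (\<lambda>_. c) = c"
  obtains x where "\<And>f. lipschitz_fun f \<Longrightarrow> ev f = f x"
proof (rule ccontr)
  assume "\<not> thesis"
  then have "\<exists>f. lipschitz_fun f \<and> ev f \<noteq> f x" for x using that by metis
  then obtain f where f: "\<And>x. lipschitz_fun (f x)" "\<And>x. ev (f x) \<noteq> f x x" by metis
  define g where "g x y = (f x y - ev (f x)) * (f x y - ev (f x))" for x y
  have d: "lipschitz_fun (\<lambda>y. f x y - ev (f x))" for x
    by (intro lipschitz_fun_diff f) simp
  have g: "lipschitz_fun (g x)" for x
    unfolding g_def by (intro bdd_lip_quotients_mult d)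
  have "ev (\<lambda>y. f x y - ev (f x)) = 0" for x
    using add[of "f x" "\<lambda>_. - ev (f x)"] f(1) by (simp add: const)
  then have ev_g: "ev (g x) = 0" for x
    unfolding g_def by (simp add: mult d)
  have g_nonneg: "0 \<le> g x y" for x y by (simp add: g_def)
  have "UNIV \<subseteq> (\<Union>x\<in>UNIV. {y. 0 < g x y})"
    using f(2) by (auto simp: g_def) (metis eq_iff_diff_eq_0 not_real_square_gt_zero)
  moreover have "open {y. 0 < g x y}" for x
    using lipschitz_fun_continuous[OF g]
    by (intro open_Collect_less) auto
  ultimately obtain T where T: "finite T" "UNIV \<subseteq> (\<Union>x\<in>T. {y. 0 < g x y})"
    using compactE_image[OF compact_space[where 'a = 'x], of UNIV "\<lambda>x. {y. 0 < g x y}"] by metis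
  define G where "G y = (\<Sum>x\<in>T. g x y)" for y
  have G: "lipschitz_fun G" unfolding G_def by (intro lipschitz_fun_sum T g)
  have "ev (\<lambda>y. \<Sum>x\<in>T. g x y) = 0"
    using T(1)
  proof (induction T rule: finite_induct)
    case (insert a S)
    then show ?case by (simp add: add g lipschitz_fun_sum ev_g)
  qed (simp add: const)
  then have ev_G: "ev G = 0" by (simp add: G_def[abs_def])
  have pos: "0 < G y" for y
  proof -
    obtain x where "x \<in> T" "0 < g x y" using T(2) by blast
    then show ?thesis unfolding G_def by (intro sum_pos2[OF T(1)]) (auto simp: g_nonneg)
  qed
  obtain y0 where "\<And>y. G y0 \<le> G y"
    using continuous_attains_inf[OF compact_space _ lipschitz_fun_continuous[OF G]] by auto
  then have inv: "lipschitz_fun (\<lambda>y. inverse (G y))"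
    by (intro lipschitz_fun_inverse[OF G pos[of y0]])
  have "G y * inverse (G y) = 1" for y using pos[of y] by simp
  then have "ev (\<lambda>_. 1) = ev (\<lambda>y. G y * inverse (G y))" by simp
  also have "\<dots> = ev G * ev (\<lambda>y. inverse (G y))" by (rule mult[OF G inv])
  finally show False by (simp add: const ev_G)
qed

section \<open>Jordan isomorphisms\<close>

lemma jordan_star_homD:
  assumes "jordan_star_hom J"
  shows "J (a + b) = J a + J b" "J (c *\<^sub>C a) = c *\<^sub>C J a"
    "J (jordan_prod a b) = jordan_prod (J a) (J b)" "J (star a) = star (J a)"
    "J (r *\<^sub>R a) = r *\<^sub>R J a" "J (a - b) = J a - J b" "J 0 = 0"
proof -
  show add: "J (a + b) = J a + J b" for a b using assms by (simp add: jordan_star_hom_def)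
  show "J (c *\<^sub>C a) = c *\<^sub>C J a" "J (jordan_prod a b) = jordan_prod (J a) (J b)"
    "J (star a) = star (J a)" "J (r *\<^sub>R a) = r *\<^sub>R J a"
    using assms by (simp_all add: jordan_star_hom_def scaleR_scaleC)
  show "J (a - b) = J a - J b" using add[of "a - b" b] by (simp add: algebra_simps)
  show "J 0 = 0" using add[of 0 0] by simp
qed

lemma jordan_prod_eq: "jordan_prod a b = (1 / 2) *\<^sub>R (a * b + b * a)"
  by (simp add: jordan_prod_def scaleR_scaleC)

lemma jordan_prod_commuting: "a * b = b * a \<Longrightarrow> jordan_prod a b = a * b"
  by (simp add: jordan_prod_eq flip: scaleR_2)

lemma jordan_star_hom_anticommutator:
  assumes "jordan_star_hom J"
  shows "J (a * b + b * a) = J a * J b + J b * J a"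
  using arg_cong[OF jordan_star_homD(3)[OF assms, of a b], of "\<lambda>x. 2 *\<^sub>R x"]
  by (simp add: jordan_prod_eq jordan_star_homD(5)[OF assms] del: scaleR_right_distrib)

text \<open>The double commutator is a Jordan expression: with \<open>a \<bullet> b = ab + ba\<close> one has
  \<open>[[a, b], c] = a \<bullet> (b \<bullet> c) - b \<bullet> (a \<bullet> c)\<close>.\<close>

lemma jordan_star_hom_double_commutator:
  assumes J: "jordan_star_hom J"
  shows "J ((a * b - b * a) * c - c * (a * b - b * a))
    = (J a * J b - J b * J a) * J c - J c * (J a * J b - J b * J a)"
proof -
  have *: "(a * b - b * a) * c - c * (a * b - b * a)
    = (a * (b * c + c * b) + (b * c + c * b) * a) - (b * (a * c + c * a) + (a * c + c * a) * b)"
    for a b c :: "'z::complex_star_algebra"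
    by (simp add: algebra_simps)
  show ?thesis
    unfolding * jordan_star_homD(6)[OF J] jordan_star_hom_anticommutator[OF J] ..
qed

text \<open>The double commutator shows only that each \<open>[J a, b]\<close> is central;
  \<open>semiprime\<close> must turn this into zero. It is a hypothesis because the Lipschitz
  algebra is not itself a C*-algebra.\<close>

lemma jordan_star_iso_central:
  fixes J :: "'a::complex_star_algebra \<Rightarrow> 'b::complex_star_algebra"
  assumes J: "jordan_star_iso J"
    and semiprime: "\<And>z::'b. (\<And>w. z * w = w * z) \<Longrightarrow> z * z = 0 \<Longrightarrow> z = 0"
    and a: "\<And>w. a * w = w * a"
  shows "J a * b = b * J a"
proof -
  have hom: "jordan_star_hom J" and surj: "surj J"
    using J by (auto simp: jordan_star_iso_def bij_is_surj)
  have central: "(J a * b - b * J a) * c = c * (J a * b - b * J a)" for b c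
  proof -
    obtain b' c' where "b = J b'" "c = J c'" using surj by (metis surj_def)
    then show ?thesis
      using jordan_star_hom_double_commutator[OF hom, of a b' c'] a[of b'] jordan_star_homD(7)[OF hom]
      by simp
  qed
  let ?d = "J a * b - b * J a"
  \<comment> \<open>Since \<open>[J a, J a * b] = J a * d\<close>, this element is central as well;
    moving the central \<open>d\<close> aside gives \<open>[J a, b] * d = 0\<close>.\<close>
  have "(J a * ?d) * b = b * (J a * ?d)"
    using central[of "J a * b" b] by (simp add: algebra_simps)
  then have "(J a * b) * ?d = (b * J a) * ?d"
    by (metis central mult.assoc)
  then have "?d * ?d = 0" by (simp add: left_diff_distrib)
  from semiprime[OF central this] show ?thesis by simp
qed

text \<open>As \<open>z\<close> commutes with \<open>star z\<close>, the self-adjoint element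
  \<open>star z * z\<close> squares to zero; the C*-identity is then applied twice.\<close>

lemma cstar_central_square_zero:
  fixes z :: "'a::unital_cstar_algebra"
  assumes "\<And>w. z * w = w * z" and "z * z = 0"
  shows "z = 0"
proof -
  have "star (star z * z) * (star z * z) = star z * (z * star z) * z"
    by (simp add: star_mult star_star mult.assoc)
  also have "\<dots> = star z * star z * (z * z)"
    by (simp only: assms(1)[of "star z"] mult.assoc)
  finally have "norm (star z * z) = 0"
    using cstar_identity[of "star z * z"] assms(2) by simp
  then show ?thesis using cstar_identity[of z] by simp
qed

lemma lip_central_iff:
  "(\<forall>G. F * G = G * F) \<longleftrightarrow> (\<forall>x w. lip_apply F x * w = w * lip_apply F x)"
proof
  assume F: "\<forall>G. F * G = G * F"
  show "\<forall>x w. lip_apply F x * w = w * lip_apply F x"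
  proof (intro allI)
    fix x w
    show "lip_apply F x * w = w * lip_apply F x"
      using arg_cong[OF F[rule_format, of "lip_const w"], of "\<lambda>G. lip_apply G x"]
      by (simp add: lip_rep_eqs)
  qed
next
  assume "\<forall>x w. lip_apply F x * w = w * lip_apply F x"
  then show "\<forall>G. F * G = G * F" by (auto intro!: lip_eqI simp: lip_rep_eqs)
qed

lemma lip_central_square_zero:
  fixes F :: "('x::compact_metric_space, 'a::unital_cstar_algebra) lip"
  assumes "\<And>G. F * G = G * F" and "F * F = 0"
  shows "F = 0"
proof (rule lip_eqI)
  fix x
  have central: "lip_apply F x * w = w * lip_apply F x" for w
    using lip_central_iff[of F] assms(1) by blast
  have "lip_apply F x * lip_apply F x = 0"
    using arg_cong[OF assms(2), of "\<lambda>G. lip_apply G x"] by (simp add: lip_rep_eqs)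
  from cstar_central_square_zero[OF central this] show "lip_apply F x = lip_apply 0 x"
    by (simp add: lip_rep_eqs)
qed

lemma star_one: "star (1::'a::unital_cstar_algebra) = 1"
  by (metis mult.right_neutral mult.left_neutral star_mult star_star)

lemma star_zero: "star (0::'a::complex_star_algebra) = 0"
  using star_add[of "0::'a" 0] by simp

lemma lip_const_add: "lip_const (a + b) = lip_const a + lip_const b"
  and lip_const_scaleC: "lip_const (c *\<^sub>C a) = c *\<^sub>C lip_const a"
  and lip_const_jordan_prod: "lip_const (jordan_prod a b) = jordan_prod (lip_const a) (lip_const b)"
  and lip_const_star: "lip_const (star a) = star (lip_const a)"
  by (auto intro!: lip_eqI simp: lip_rep_eqs jordan_prod_def)

lemma lip_apply_jordan_prod:
  "lip_apply (jordan_prod F G) x = jordan_prod (lip_apply F x) (lip_apply G x)"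
  by (simp add: jordan_prod_def lip_rep_eqs)

lemma jordan_prod_scalar [simp]:
  fixes a :: "'a::unital_cstar_algebra"
  shows "jordan_prod (r *\<^sub>R 1) a = r *\<^sub>R a"
  by (simp add: jordan_prod_eq flip: scaleR_2)

lemma jordan_prod_one [simp]:
  fixes a :: "'a::unital_cstar_algebra"
  shows "jordan_prod 1 a = a" "jordan_prod a 1 = a"
  using jordan_prod_scalar[of 1 a] by (simp_all add: jordan_prod_eq)

lemma jordan_star_iso_inv:
  assumes "jordan_star_iso J"
  shows "jordan_star_iso (inv J)"
proof -
  have hom: "jordan_star_hom J" and bij: "bij J" using assms by (auto simp: jordan_star_iso_def)
  have inv: "J (inv J b) = b" for b using bij by (simp add: bij_is_surj surj_f_inv_f)
  have inv_eq: "inv J b = a \<longleftrightarrow> b = J a" for a b using bij by (auto simp: inv bij_is_inj)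
  show ?thesis
    using bij
    by (simp add: jordan_star_iso_def jordan_star_hom_def inv_eq jordan_star_homD[OF hom] inv bij_imp_bij_inv)
qed

section \<open>Images of scalar functions\<close>

text \<open>The type \<open>lip\<close> carries no \<open>1\<close>; \<open>lip_const 1\<close> is
  recognized as the Jordan unit, tested on a preimage of the target unit.\<close>

lemma jordan_star_iso_one:
  fixes J :: "('x1::compact_metric_space, 'a1::unital_cstar_algebra) lip \<Rightarrow>
              ('x2::compact_metric_space, 'a2::unital_cstar_algebra) lip"
  assumes J: "jordan_star_iso J"
  shows "J (lip_const 1) = lip_const 1"
proof -
  have hom: "jordan_star_hom J" and bij: "bij J" using J by (auto simp: jordan_star_iso_def)
  obtain E where E: "J E = lip_const 1" using bij by (metis bij_is_surj surjD)
  have "jordan_prod (lip_const 1) E = E"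
    by (intro lip_eqI) (simp add: lip_apply_jordan_prod)
  then have "jordan_prod (J (lip_const 1)) (lip_const 1) = lip_const 1"
    using jordan_star_homD(3)[OF hom, of "lip_const 1" E] by (simp add: E)
  moreover have "jordan_prod (J (lip_const 1)) (lip_const 1) = J (lip_const 1)"
    by (intro lip_eqI) (simp add: lip_apply_jordan_prod)
  ultimately show ?thesis by simp
qed

lemma lip_scalar_central:
  assumes "lipschitz_fun f"
  shows "lip_scalar f * F = F * lip_scalar f"
  by (intro lip_eqI) (simp add: lip_rep_eqs assms)

lemma jordan_star_iso_lip_scalar:
  fixes J :: "('x1::compact_metric_space, 'a1::unital_cstar_algebra) lip \<Rightarrow>
              ('x2::compact_metric_space, 'a2::unital_cstar_algebra) lip"
  assumes J: "jordan_star_iso J"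
    and center: "\<And>z::'a2. (\<And>w. z * w = w * z) \<Longrightarrow> \<exists>c. z = c *\<^sub>C 1"
    and f: "lipschitz_fun f"
  shows "\<exists>r::real. lip_apply (J (lip_scalar f)) y = r *\<^sub>R 1"
proof -
  have hom: "jordan_star_hom J" using J by (auto simp: jordan_star_iso_def)
  have "J (lip_scalar f) * G = G * J (lip_scalar f)" for G
    by (rule jordan_star_iso_central[OF J lip_central_square_zero lip_scalar_central[OF f]])
  then have "\<forall>G. J (lip_scalar f) * G = G * J (lip_scalar f)" by blast
  then obtain c where c: "lip_apply (J (lip_scalar f)) y = c *\<^sub>C 1"
    using center[of "lip_apply (J (lip_scalar f)) y"] unfolding lip_central_iff by blast
  have "star (lip_scalar f) = (lip_scalar f :: ('x1, 'a1) lip)"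
    by (intro lip_eqI) (simp add: lip_rep_eqs f star_scaleC star_one scaleR_scaleC)
  from arg_cong[OF this, of "\<lambda>F. lip_apply (J F) y"]
  have "cnj c *\<^sub>C (1::'a2) = c *\<^sub>C 1"
    by (simp add: jordan_star_homD(4)[OF hom] lip_rep_eqs c star_scaleC star_one)
  \<comment> \<open>Averaging \<open>c\<close> with its conjugate replaces it by
    \<open>Re c\<close>.\<close>
  then have "(1 / 2) *\<^sub>R (c *\<^sub>C (1::'a2) + cnj c *\<^sub>C 1) = c *\<^sub>C 1" by (simp flip: scaleR_2)
  moreover have "c *\<^sub>C (1::'a2) + cnj c *\<^sub>C 1 = (2 * Re c) *\<^sub>R 1"
    by (simp add: complex_add_cnj scaleR_scaleC flip: scaleC_add_left)
  ultimately show ?thesis using c by (metis scaleR_scaleR)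
qed

lemma jordan_star_iso_point_evaluation:
  fixes J :: "('x1::compact_metric_space, 'a1::unital_cstar_algebra) lip \<Rightarrow>
              ('x2::compact_metric_space, 'a2::unital_cstar_algebra) lip"
  assumes J: "jordan_star_iso J"
    and center: "\<And>z::'a2. (\<And>w. z * w = w * z) \<Longrightarrow> \<exists>c. z = c *\<^sub>C 1"
  shows "\<exists>x. \<forall>f. lipschitz_fun f \<longrightarrow> lip_apply (J (lip_scalar f)) y = f x *\<^sub>R 1"
proof -
  have hom: "jordan_star_hom J" using J by (auto simp: jordan_star_iso_def)
  obtain ev where ev: "lip_apply (J (lip_scalar f)) y = ev f *\<^sub>R 1" if "lipschitz_fun f" for f
    using jordan_star_iso_lip_scalar[OF J center, of _ y] by metis
  have add: "ev (\<lambda>x. f x + g x) = ev f + ev g" if fg: "lipschitz_fun f" "lipschitz_fun g" for f g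
  proof -
    have "lip_scalar (\<lambda>x. f x + g x) = (lip_scalar f + lip_scalar g :: ('x1, 'a1) lip)"
      by (intro lip_eqI) (simp add: lip_rep_eqs fg bdd_lip_quotients_add(1) scaleR_add_left)
    from arg_cong[OF this, of "\<lambda>F. lip_apply (J F) y"]
    have "ev (\<lambda>x. f x + g x) *\<^sub>R (1::'a2) = (ev f + ev g) *\<^sub>R 1"
      by (simp add: jordan_star_homD(1)[OF hom] lip_rep_eqs ev fg bdd_lip_quotients_add(1) scaleR_add_left)
    then show ?thesis by simp
  qed
  have mult: "ev (\<lambda>x. f x * g x) = ev f * ev g" if fg: "lipschitz_fun f" "lipschitz_fun g" for f g
  proof -
    have "lip_scalar (\<lambda>x. f x * g x) = jordan_prod (lip_scalar f) (lip_scalar g :: ('x1, 'a1) lip)"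
      by (intro lip_eqI) (simp add: lip_apply_jordan_prod fg bdd_lip_quotients_mult)
    from arg_cong[OF this, of "\<lambda>F. lip_apply (J F) y"]
    have "ev (\<lambda>x. f x * g x) *\<^sub>R (1::'a2) = (ev f * ev g) *\<^sub>R 1"
      by (simp add: jordan_star_homD(3)[OF hom] lip_apply_jordan_prod ev fg bdd_lip_quotients_mult)
    then show ?thesis by simp
  qed
  have const: "ev (\<lambda>_. c) = c" for c
  proof -
    have "lip_scalar (\<lambda>_. c) = (c *\<^sub>R lip_const 1 :: ('x1, 'a1) lip)"
      by (intro lip_eqI) (simp add: lip_rep_eqs)
    from arg_cong[OF this, of "\<lambda>F. lip_apply (J F) y"]
    have "ev (\<lambda>_. c) *\<^sub>R (1::'a2) = c *\<^sub>R 1"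
      by (simp add: jordan_star_homD(5)[OF hom] jordan_star_iso_one[OF J] lip_rep_eqs ev)
    then show ?thesis by simp
  qed
  obtain x where "\<And>f. lipschitz_fun f \<Longrightarrow> ev f = f x"
    using lipschitz_character_evaluation[of ev, OF add mult const] by metis
  then show ?thesis using ev by metis
qed

section \<open>Localization of \<open>J\<close> at a point\<close>

text \<open>The slope \<open>b\<close> enters only multiplied by the supremum bound
  \<open>a\<close>, so squares become small when \<open>a\<close> does while \<open>b\<close> stays
  bounded.\<close>

lemma norm_square_lip_le:
  assumes "\<And>x. norm (lip_apply F x) \<le> a"
    and "\<And>x y. norm (lip_apply F x - lip_apply F y) \<le> b * dist x y" and "0 \<le> a" "0 \<le> b"
  shows "norm (F * F) \<le> a * a + 2 * a * b"
proof (rule norm_lip_le)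
  fix x y
  show "norm (lip_apply (F * F) x) \<le> a * a"
    unfolding lip_rep_eqs
    by (rule order_trans[OF norm_mult_ineq]) (intro mult_mono assms norm_ge_zero)
  have "lip_apply (F * F) x - lip_apply (F * F) y
      = lip_apply F x * (lip_apply F x - lip_apply F y) + (lip_apply F x - lip_apply F y) * lip_apply F y"
    by (simp add: lip_rep_eqs algebra_simps)
  also have "norm \<dots> \<le> a * (b * dist x y) + (b * dist x y) * a"
    by (intro norm_triangle_le add_mono; rule order_trans[OF norm_mult_ineq]; intro mult_mono assms)
      (auto intro!: mult_nonneg_nonneg assms)
  finally show "norm (lip_apply (F * F) x - lip_apply (F * F) y) \<le> 2 * a * b * dist x y" by simp
qed (use assms in auto)

text \<open>\<open>G\<^sub>n(x) = F(x) / (1 + n d(x, p))\<close> has the same image at \<open>y\<close> as \<open>F\<close>. Its Lipschitz constant is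
  bounded in \<open>n\<close> while its supremum tends to \<open>0\<close>, so \<open>G\<^sub>n\<^sup>2\<close> tends to \<open>0\<close> in the Lipschitz norm and
  the C*-identity at \<open>y\<close> applies.\<close>

lemma jordan_star_iso_vanishes_selfadjoint:
  fixes J :: "('x1::compact_metric_space, 'a1::unital_cstar_algebra) lip \<Rightarrow>
              ('x2::compact_metric_space, 'a2::unital_cstar_algebra) lip"
  assumes J: "jordan_star_iso J" and bl: "bounded_linear J"
    and p: "\<And>f. lipschitz_fun f \<Longrightarrow> lip_apply (J (lip_scalar f)) y = f p *\<^sub>R 1"
    and sa: "star F = F" and F: "lip_apply F p = 0"
  shows "lip_apply (J F) y = 0"
proof -
  have hom: "jordan_star_hom J" using J by (auto simp: jordan_star_iso_def)
  obtain C where C: "0 \<le> C" "\<And>F. norm (J F) \<le> norm F * C"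
    using bounded_linear.nonneg_bounded[OF bl] by blast
  let ?L = "norm F"
  have FL: "norm (lip_apply F x) \<le> ?L * dist x p" for x
    using norm_lip_apply_diff_le[of F x p] by (simp add: F)
  have "(norm (lip_apply (J F) y))\<^sup>2 \<le> 5 * ?L\<^sup>2 * C * inverse (real (Suc n))" for n
  proof -
    let ?n = "real (Suc n)"
    define h where "h x = inverse (1 + ?n * dist x p)" for x
    have pos: "0 < 1 + ?n * dist x p" for x by (simp add: add_pos_nonneg)
    have h_bounds: "0 < h x" for x
      unfolding h_def using pos[of x] by simp
    have hd: "?n * dist x p * h x \<le> 1" for x
      unfolding h_def using pos[of x] by (simp add: divide_simps)
    have h1: "h x \<le> 1" for x
      unfolding h_def using pos[of x] by (simp add: divide_simps)
    \<comment> \<open>The factor \<open>h z\<close> is kept: with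
      \<open>norm (F z) \<le> L d(z, p)\<close> and \<open>n d(z, p) h z \<le> 1\<close> it cancels
      the factor \<open>n\<close>.\<close>
    have hdiff: "\<bar>h x - h z\<bar> \<le> ?n * dist x z * h z" for x z
    proof -
      have "h x - h z = h x * h z * (?n * (dist z p - dist x p))"
        unfolding h_def using pos[of x] pos[of z] by (simp add: field_simps)
      then have "\<bar>h x - h z\<bar> = h x * (h z * (?n * \<bar>dist z p - dist x p\<bar>))"
        using h_bounds[of x] h_bounds[of z] by (simp add: abs_mult)
      also have "\<dots> \<le> 1 * (h z * (?n * dist x z))"
        using h_bounds[of z] h_bounds[of x] abs_dist_diff_le[of z p x]
        by (intro mult_mono h1) (auto simp: dist_commute intro!: mult_nonneg_nonneg)
      finally show ?thesis by (simp add: mult_ac)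
    qed
    have h: "lipschitz_fun h"
    proof (rule lip_quotients_bound(1))
      fix x z
      show "norm (h x - h z) \<le> ?n * dist x z"
        using order_trans[OF hdiff[of x z] mult_left_mono[OF h1[of z], of "?n * dist x z"]] by simp
    qed
    define G where "G = lip_scalar h * F"
    have G: "lip_apply G x = h x *\<^sub>R lip_apply F x" for x
      by (simp add: G_def lip_rep_eqs h)
    \<comment> \<open>Supremum bound \<open>L / n\<close> and slope \<open>2 L\<close> give
      \<open>L^2 / n^2 + 4 L^2 / n\<close>, hence the constant 5.\<close>
    have "norm (G * G) \<le> (?L * inverse ?n) * (?L * inverse ?n) + 2 * (?L * inverse ?n) * (2 * ?L)"
    proof (rule norm_square_lip_le)
      fix x z
      have "norm (lip_apply G x) \<le> h x * (?L * dist x p)"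
        unfolding G using h_bounds[of x] FL[of x] by (simp add: mult_left_mono)
      also have "\<dots> = (?L * inverse ?n) * (?n * dist x p * h x)" by simp
      also have "\<dots> \<le> (?L * inverse ?n) * 1" by (intro mult_left_mono hd) simp
      finally show "norm (lip_apply G x) \<le> ?L * inverse ?n" by simp
      have "lip_apply G x - lip_apply G z
          = h x *\<^sub>R (lip_apply F x - lip_apply F z) + (h x - h z) *\<^sub>R lip_apply F z"
        by (simp add: G algebra_simps)
      also have "norm \<dots> \<le> 1 * (?L * dist x z) + (?n * dist x z * h z) * (?L * dist z p)"
        using h_bounds[of x] h_bounds[of z] hdiff[of x z]
        by (intro norm_triangle_le add_mono; unfold norm_scaleR; intro mult_mono)
          (auto simp: h1 FL norm_lip_apply_diff_le)
      also have "\<dots> = ?L * dist x z + (?L * dist x z) * (?n * dist z p * h z)" by simp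
      also have "\<dots> \<le> ?L * dist x z + (?L * dist x z) * 1"
        by (intro add_left_mono mult_left_mono hd) simp
      finally show "norm (lip_apply G x - lip_apply G z) \<le> 2 * ?L * dist x z" by simp
    qed auto
    also have "\<dots> \<le> 5 * ?L\<^sup>2 * inverse ?n"
    proof -
      have "?L\<^sup>2 * inverse ?n * inverse ?n \<le> ?L\<^sup>2 * inverse ?n * 1"
        by (intro mult_left_mono) (simp_all add: field_simps)
      then show ?thesis by (simp add: power2_eq_square mult_ac)
    qed
    finally have GG: "norm (G * G) \<le> 5 * ?L\<^sup>2 * inverse ?n" .
    \<comment> \<open>\<open>J\<close> turns the factor \<open>h\<close> into \<open>h p = 1\<close>
      at \<open>y\<close>.\<close>
    have "lip_apply (J G) y = lip_apply (J F) y"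
    proof -
      have "G = jordan_prod (lip_scalar h) F"
        unfolding G_def by (simp add: jordan_prod_commuting lip_scalar_central[OF h])
      then show ?thesis
        by (simp add: jordan_star_homD(3)[OF hom] lip_apply_jordan_prod p[OF h]) (simp add: h_def)
    qed
    moreover have "J (G * G) = J G * J G"
      using jordan_star_homD(3)[OF hom, of G G] by (simp add: jordan_prod_commuting)
    moreover have "star (lip_apply (J F) y) = lip_apply (J F) y"
      using arg_cong[OF sa, of "\<lambda>F. lip_apply (J F) y"] by (simp add: jordan_star_homD(4)[OF hom] lip_rep_eqs)
    ultimately have "(norm (lip_apply (J F) y))\<^sup>2 = norm (lip_apply (J (G * G)) y)"
      using cstar_identity[of "lip_apply (J F) y"] by (simp add: lip_rep_eqs)
    also have "\<dots> \<le> norm (G * G) * C"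
      using norm_lip_apply_le C(2) by (rule order_trans)
    also have "\<dots> \<le> 5 * ?L\<^sup>2 * inverse ?n * C" by (intro mult_right_mono GG C)
    finally show ?thesis by (simp add: mult_ac)
  qed
  moreover have "(\<lambda>n. 5 * ?L\<^sup>2 * C * inverse (real (Suc n))) \<longlonglongrightarrow> 5 * ?L\<^sup>2 * C * 0"
    by (intro tendsto_intros LIMSEQ_inverse_real_of_nat)
  ultimately have "(norm (lip_apply (J F) y))\<^sup>2 \<le> 0"
    by (intro LIMSEQ_le_const[where a = "(norm (lip_apply (J F) y))\<^sup>2"]) auto
  then show ?thesis by simp
qed

text \<open>Both \<open>F + star F\<close> and \<open>\<i> *\<^sub>C (F - star F)\<close> are
  self-adjoint and inherit the zero at \<open>p\<close>.\<close>

lemma jordan_star_iso_vanishes: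
  fixes J :: "('x1::compact_metric_space, 'a1::unital_cstar_algebra) lip \<Rightarrow>
              ('x2::compact_metric_space, 'a2::unital_cstar_algebra) lip"
  assumes J: "jordan_star_iso J" and bl: "bounded_linear J"
    and p: "\<And>f. lipschitz_fun f \<Longrightarrow> lip_apply (J (lip_scalar f)) y = f p *\<^sub>R 1"
    and F: "lip_apply F p = 0"
  shows "lip_apply (J F) y = 0"
proof -
  have hom: "jordan_star_hom J" using J by (auto simp: jordan_star_iso_def)
  have sa: "lip_apply (J H) y = 0" if "star H = H" "lip_apply H p = 0" for H
    using jordan_star_iso_vanishes_selfadjoint[OF J bl _ that] p by blast
  let ?D = "\<i> *\<^sub>C (F - star F)"
  have "star ?D = ?D"
  proof -
    have "star ?D = (- \<i>) *\<^sub>C (star F - F)"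
      by (simp add: star_scaleC star_diff star_star)
    also have "\<dots> = ((- \<i>) * (- 1)) *\<^sub>C (F - star F)"
      unfolding scaleC_scaleC[symmetric] using scaleR_scaleC[of "- 1" "F - star F"] by simp
    finally show ?thesis by simp
  qed
  moreover have "lip_apply ?D p = 0"
    using norm_scaleC[of \<i> "0::'a1"] by (simp add: lip_rep_eqs F star_zero)
  ultimately have "lip_apply (J ?D) y = 0" by (rule sa)
  then have "norm (lip_apply (J F) y - lip_apply (J (star F)) y) = 0"
    using norm_scaleC[of \<i> "lip_apply (J F) y - lip_apply (J (star F)) y"]
    by (simp add: jordan_star_homD(2,6)[OF hom] lip_rep_eqs)
  moreover have "lip_apply (J (F + star F)) y = 0"
    by (rule sa) (simp_all add: lip_rep_eqs F star_zero star_add star_star add.commute)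
  ultimately have "2 *\<^sub>R lip_apply (J F) y = 0"
    by (simp add: jordan_star_homD(1)[OF hom] lip_rep_eqs scaleR_2)
  then show ?thesis by simp
qed

text \<open>The Lipschitz bound on \<open>\<phi>\<close> comes from the test functions
  \<open>dist x (\<phi> z)\<close>. Their norms are at most \<open>D + 1\<close> for all
  \<open>z\<close>: the diameter \<open>D\<close> bounds the values and 1 the slope.\<close>

lemma jordan_star_iso_point_map:
  fixes J :: "('x1::compact_metric_space, 'a1::unital_cstar_algebra) lip \<Rightarrow>
              ('x2::compact_metric_space, 'a2::unital_cstar_algebra) lip"
  assumes J: "jordan_star_iso J" and bl: "bounded_linear J"
    and center: "\<And>z::'a2. (\<And>w. z * w = w * z) \<Longrightarrow> \<exists>c. z = c *\<^sub>C 1"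
  obtains \<phi> K where "K-lipschitz_on UNIV \<phi>"
    and "\<And>f y. lipschitz_fun f \<Longrightarrow> lip_apply (J (lip_scalar f)) y = f (\<phi> y) *\<^sub>R 1"
    and "\<And>F y. lip_apply F (\<phi> y) = 0 \<Longrightarrow> lip_apply (J F) y = 0"
proof -
  obtain \<phi> where \<phi>: "lip_apply (J (lip_scalar f)) y = f (\<phi> y) *\<^sub>R 1"
    if "lipschitz_fun f" for f y
    using jordan_star_iso_point_evaluation[OF J center] by metis
  obtain C where C: "0 \<le> C" "\<And>F. norm (J F) \<le> norm F * C"
    using bounded_linear.nonneg_bounded[OF bl] by blast
  define D where "D = diameter (UNIV :: 'x1 set)"
  have D: "dist x p \<le> D" for x p :: 'x1
    unfolding D_def by (rule diameter_bounded_bound) (simp_all add: compact_imp_bounded compact_space)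
  have "0 \<le> D" using zero_le_dist D by (rule order_trans)
  have "((D + 1) * C)-lipschitz_on UNIV \<phi>"
  proof (rule lipschitz_onI)
    fix y z
    let ?f = "\<lambda>x. dist x (\<phi> z)"
    have "norm (lip_scalar ?f :: ('x1, 'a1) lip) \<le> D + 1"
      by (rule norm_lip_le) (simp_all add: D flip: scaleR_diff_left, metis abs_dist_diff_le dist_commute)
    then have *: "norm (J (lip_scalar ?f)) \<le> (D + 1) * C"
      using C by (meson mult_right_mono order_trans)
    have "dist (\<phi> y) (\<phi> z) = norm (lip_apply (J (lip_scalar ?f)) y - lip_apply (J (lip_scalar ?f)) z)"
      by (simp add: \<phi>)
    also have "\<dots> \<le> (D + 1) * C * dist y z"
      using norm_lip_apply_diff_le mult_right_mono[OF * zero_le_dist] by (rule order_trans)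
    finally show "dist (\<phi> y) (\<phi> z) \<le> (D + 1) * C * dist y z" .
  qed (use C \<open>0 \<le> D\<close> in auto)
  moreover have "lip_apply (J F) y = 0" if "lip_apply F (\<phi> y) = 0" for F y
    using jordan_star_iso_vanishes[OF J bl _ that] \<phi> by blast
  ultimately show ?thesis using that \<phi> by blast
qed

section \<open>Inverse point maps and strong Lipschitz estimates\<close>

text \<open>\<open>J\<close> followed by \<open>J'\<close> turns the distance to \<open>x\<close>
  into its composition with \<open>\<phi> \<circ> \<psi>\<close>; evaluated at \<open>x\<close> this
  must still be zero.\<close>

lemma point_maps_inverse:
  fixes J :: "('x1::compact_metric_space, 'a1::unital_cstar_algebra) lip \<Rightarrow>
              ('x2::compact_metric_space, 'a2::unital_cstar_algebra) lip"
  assumes inv: "\<And>F. J' (J F) = F"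
    and \<phi>: "\<And>f y. lipschitz_fun f \<Longrightarrow> lip_apply (J (lip_scalar f)) y = f (\<phi> y) *\<^sub>R 1"
    and \<psi>: "\<And>f x. lipschitz_fun f \<Longrightarrow> lip_apply (J' (lip_scalar f)) x = f (\<psi> x) *\<^sub>R 1"
  shows "\<phi> (\<psi> x) = x"
proof -
  let ?f = "\<lambda>z. dist z x"
  have lip: "lipschitz_fun (\<lambda>y. ?f (\<phi> y))"
  proof (rule lip_quotients_bound(1))
    fix y z
    show "norm (?f (\<phi> y) - ?f (\<phi> z)) \<le> norm (J (lip_scalar ?f)) * dist y z"
      using norm_lip_apply_diff_le[of "J (lip_scalar ?f)" y z] by (simp add: \<phi> flip: scaleR_diff_left)
  qed
  have "J (lip_scalar ?f) = lip_scalar (\<lambda>y. ?f (\<phi> y))"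
    by (intro lip_eqI) (simp add: \<phi> lip)
  then have "lip_apply (lip_scalar ?f :: ('x1, 'a1) lip) x = ?f (\<phi> (\<psi> x)) *\<^sub>R 1"
    using inv[of "lip_scalar ?f"] \<psi>[OF lip, of x] by simp
  then show ?thesis by simp
qed

lemma sot_lipschitz_constants:
  fixes J :: "('x1::compact_metric_space, 'a1::unital_cstar_algebra) lip \<Rightarrow>
              ('x2::compact_metric_space, 'a2::unital_cstar_algebra) lip"
  assumes hom: "jordan_star_hom J" and bl: "bounded_linear J"
  shows "sot_lipschitz (\<lambda>y a. lip_apply (J (lip_const a)) y)"
proof -
  obtain K where K: "0 < K" "\<And>F. norm (J F) \<le> norm F * K"
    using bounded_linear.pos_bounded[OF bl] by blast
  have bound: "norm (J (lip_const a)) \<le> norm a * K" for a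
    using K mult_right_mono[OF norm_lip_const_le[of a], of K] by (meson less_imp_le order_trans)
  have scale: "lip_apply (J (lip_const (c *\<^sub>C a))) y = c *\<^sub>C lip_apply (J (lip_const a)) y" for c a y
    by (simp add: lip_const_scaleC jordan_star_homD[OF hom] lip_rep_eqs)
  have "bounded_clinear (\<lambda>a. lip_apply (J (lip_const a)) y)" for y
    unfolding bounded_clinear_def
  proof (intro conjI allI scale bounded_linear_intro[where K = K])
    fix a b :: 'a1 and r :: real
    show "lip_apply (J (lip_const (a + b))) y = lip_apply (J (lip_const a)) y + lip_apply (J (lip_const b)) y"
      by (simp add: lip_const_add jordan_star_homD[OF hom] lip_rep_eqs)
    show "lip_apply (J (lip_const (r *\<^sub>R a))) y = r *\<^sub>R lip_apply (J (lip_const a)) y"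
      by (simp add: scaleR_scaleC scale)
    show "norm (lip_apply (J (lip_const a)) y) \<le> norm a * K"
      using norm_lip_apply_le bound by (rule order_trans)
  qed
  moreover have "norm (lip_apply (J (lip_const a)) y - lip_apply (J (lip_const a)) z) \<le> K * norm a * dist y z"
    for a y z
    using norm_lip_apply_diff_le[of "J (lip_const a)" y z] mult_right_mono[OF bound[of a] zero_le_dist[of y z]]
    by (simp add: mult.commute)
  ultimately show ?thesis using K(1) by (auto simp: sot_lipschitz_def)
qed

text \<open>The increment splits into a change of operator and a change of argument. The latter
  needs a bound on \<open>W y\<close> uniform in \<open>y\<close>, obtained from one base point,
  here \<open>undefined\<close>, and the finite diameter.\<close>

lemma sot_lipschitz_composition:
  fixes W :: "'y::compact_metric_space \<Rightarrow> 'a::unital_cstar_algebra \<Rightarrow> 'b::unital_cstar_algebra"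
    and \<phi> :: "'y \<Rightarrow> 'x::compact_metric_space"
  assumes W: "sot_lipschitz W" and \<phi>: "C-lipschitz_on UNIV \<phi>"
  obtains M where "0 \<le> M"
    and "\<And>F y. norm (W y (lip_apply F (\<phi> y))) \<le> M * norm F"
    and "\<And>F y z. norm (W y (lip_apply F (\<phi> y)) - W z (lip_apply F (\<phi> z))) \<le> M * norm F * dist y z"
proof -
  obtain K where K: "0 < K" "\<And>a y z. norm (W y a - W z a) \<le> K * norm a * dist y z"
    using W by (auto simp: sot_lipschitz_def)
  have bl: "bounded_linear (W y)" for y using W by (auto simp: sot_lipschitz_def bounded_clinear_def)
  define D where "D = diameter (UNIV :: 'y set)"
  have D: "dist y z \<le> D" for y z :: 'y
    unfolding D_def by (rule diameter_bounded_bound) (simp_all add: compact_imp_bounded compact_space)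
  have "0 \<le> D" using zero_le_dist D by (rule order_trans)
  have "0 \<le> C" using \<phi> by (rule lipschitz_on_nonneg)
  obtain B where B: "0 \<le> B" "\<And>a. norm (W undefined a) \<le> norm a * B"
    using bounded_linear.nonneg_bounded[OF bl] by blast
  define N where "N = B + K * D"
  have "0 \<le> N" using B(1) K(1) \<open>0 \<le> D\<close> by (simp add: N_def)
  have N: "norm (W y a) \<le> N * norm a" for y a
  proof -
    have "norm (W y a) \<le> norm (W undefined a) + norm (W y a - W undefined a)"
      using norm_triangle_ineq[of "W undefined a" "W y a - W undefined a"] by simp
    also have "\<dots> \<le> norm a * B + K * norm a * D"
      by (intro add_mono B order_trans[OF K(2)] mult_left_mono D) (use K(1) in auto)
    finally show ?thesis by (simp add: N_def algebra_simps)
  qed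
  have "norm (W y (lip_apply F (\<phi> y)) - W z (lip_apply F (\<phi> z))) \<le> (N + K + N * C) * norm F * dist y z" for F y z
  proof -
    let ?a = "lip_apply F (\<phi> y)" and ?b = "lip_apply F (\<phi> z)"
    have "W y ?a - W z ?b = (W y ?a - W z ?a) + W z (?a - ?b)"
      by (simp add: linear_diff bounded_linear.linear[OF bl])
    also have "norm \<dots> \<le> K * norm F * dist y z + N * (norm F * (C * dist y z))"
    proof (intro norm_triangle_le add_mono)
      show "norm (W y ?a - W z ?a) \<le> K * norm F * dist y z"
        by (rule order_trans[OF K(2)]) (use K(1) norm_lip_apply_le in \<open>auto intro!: mult_right_mono mult_left_mono\<close>)
      have "norm (?a - ?b) \<le> norm F * (C * dist y z)"
        by (rule order_trans[OF norm_lip_apply_diff_le])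
          (use lipschitz_onD[OF \<phi>] in \<open>auto intro!: mult_left_mono\<close>)
      then show "norm (W z (?a - ?b)) \<le> N * (norm F * (C * dist y z))"
        using N \<open>0 \<le> N\<close> by (meson mult_left_mono order_trans)
    qed
    also have "\<dots> = (K + N * C) * norm F * dist y z" by (simp add: algebra_simps)
    also have "\<dots> \<le> (N + K + N * C) * norm F * dist y z"
      using \<open>0 \<le> N\<close> by (intro mult_right_mono) auto
    finally show ?thesis .
  qed
  moreover have "norm (W y (lip_apply F (\<phi> y))) \<le> (N + K + N * C) * norm F" for F y
  proof -
    have "norm (W y (lip_apply F (\<phi> y))) \<le> N * norm F"
      by (rule order_trans[OF N]) (use \<open>0 \<le> N\<close> norm_lip_apply_le in \<open>auto intro!: mult_left_mono\<close>)
    also have "\<dots> \<le> (N + K + N * C) * norm F"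
      using K(1) \<open>0 \<le> N\<close> \<open>0 \<le> C\<close> by (intro mult_right_mono) auto
    finally show ?thesis .
  qed
  moreover have "0 \<le> N + K + N * C" using K(1) \<open>0 \<le> N\<close> \<open>0 \<le> C\<close> by simp
  ultimately show ?thesis by (intro that) 
qed

text \<open>Algebraic laws and injectivity hold pointwise. Surjectivity is where the inverse family
  matters: its strong Lipschitz bound makes the pointwise preimage a Lipschitz function.\<close>

lemma weighted_composition_jordan_star_iso:
  fixes J :: "('x1::compact_metric_space, 'a1::unital_cstar_algebra) lip \<Rightarrow>
              ('x2::compact_metric_space, 'a2::unital_cstar_algebra) lip"
  assumes \<phi>: "lipeomorphism \<phi>" and V: "\<And>y. jordan_star_iso (V y)"
    and sot: "sot_lipschitz V" and sot_inv: "sot_lipschitz (\<lambda>x. inv (V (inv \<phi> x)))"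
    and J: "\<And>F y. lip_apply (J F) y = V y (lip_apply F (\<phi> y))"
  shows "jordan_star_iso J" and "continuous_on UNIV J"
proof -
  have bij: "bij \<phi>" using \<phi> by (simp add: lipeomorphism_def)
  obtain C C' where C: "C-lipschitz_on UNIV \<phi>" and C': "C'-lipschitz_on UNIV (inv \<phi>)"
    using \<phi> by (auto simp: lipeomorphism_def)
  have hom: "jordan_star_hom (V y)" and bijV: "bij (V y)" for y using V by (auto simp: jordan_star_iso_def)
  have J_hom: "jordan_star_hom J"
    unfolding jordan_star_hom_def
    by (intro conjI allI lip_eqI) (simp_all add: J jordan_star_homD[OF hom] lip_rep_eqs lip_apply_jordan_prod)
  moreover have "inj J"
  proof (rule injI, rule lip_eqI)
    fix F G x assume "J F = J G"
    then have "V (inv \<phi> x) (lip_apply F (\<phi> (inv \<phi> x))) = V (inv \<phi> x) (lip_apply G (\<phi> (inv \<phi> x)))"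
      by (simp flip: J)
    then show "lip_apply F x = lip_apply G x"
      using bij bijV by (auto simp: bij_is_surj surj_f_inv_f dest: bij_is_inj[THEN injD])
  qed
  moreover have "surj J"
  proof (rule surjI)
    fix G
    define f where "f x = inv (V (inv \<phi> x)) (lip_apply G (inv \<phi> x))" for x
    obtain M where "\<And>x z. norm (f x - f z) \<le> M * norm G * dist x z"
      unfolding f_def by (rule sot_lipschitz_composition[OF sot_inv C', of thesis]) blast
    then have "lip_apply (Lip f) = f" by (rule lip_apply_Lip)
    then show "J (Lip (\<lambda>x. inv (V (inv \<phi> x)) (lip_apply G (inv \<phi> x)))) = G"
      using bij bijV
      by (intro lip_eqI) (simp add: J f_def[abs_def] bij_is_inj bij_is_surj surj_f_inv_f)
  qed
  ultimately show "jordan_star_iso J" by (simp add: jordan_star_iso_def bij_def)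
  obtain M where M: "0 \<le> M"
      "\<And>F y. norm (V y (lip_apply F (\<phi> y))) \<le> M * norm F"
      "\<And>F y z. norm (V y (lip_apply F (\<phi> y)) - V z (lip_apply F (\<phi> z))) \<le> M * norm F * dist y z"
    using sot_lipschitz_composition[OF sot C] by metis
  have "norm (J F) \<le> norm F * (2 * M)" for F
    using norm_lip_le[of "J F" "M * norm F" "M * norm F"] M by (simp add: J mult_ac)
  then have "bounded_linear J"
    by (intro bounded_linear_intro[where K = "2 * M"]) (simp_all add: jordan_star_homD[OF J_hom])
  then show "continuous_on UNIV J" by (rule linear_continuous_on)
qed

theorem theorem3p6:
  fixes J :: "('x1::compact_metric_space, 'a1::unital_cstar_algebra) lip \<Rightarrow>
              ('x2::compact_metric_space, 'a2::unital_cstar_algebra) lip"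
  assumes "primitive_cstar_on TYPE('a1) TYPE('h1::complex_hilbert_space)"
    and "primitive_cstar_on TYPE('a2) TYPE('h2::complex_hilbert_space)"
  shows "jordan_star_iso J \<and> continuous_on UNIV J \<longleftrightarrow>
    (\<exists>(\<phi> :: 'x2 \<Rightarrow> 'x1) (V :: 'x2 \<Rightarrow> 'a1 \<Rightarrow> 'a2).
       lipeomorphism \<phi> \<and>
       (\<forall>y. jordan_star_iso (V y)) \<and>
       sot_lipschitz V \<and>
       sot_lipschitz (\<lambda>x. inv (V (inv \<phi> x))) \<and>
       (\<forall>F y. lip_apply (J F) y = V y (lip_apply F (\<phi> y))))"
    (is "?L \<longleftrightarrow> ?R")
proof
  assume ?R
  then show ?L using weighted_composition_jordan_star_iso by blast
next
  assume ?L
  then have J: "jordan_star_iso J" and cont: "continuous_on UNIV J" by auto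
  let ?J' = "inv J"
  have hom: "jordan_star_hom J" and bij: "bij J" using J by (auto simp: jordan_star_iso_def)
  have "linear J" by (rule linearI) (simp_all add: jordan_star_homD[OF hom])
  then have bl: "bounded_linear J" using cont by (rule bounded_linear_of_continuous)
  have bl': "bounded_linear ?J'" using bl bij by (rule bounded_inverse)
  have J': "jordan_star_iso ?J'" using J by (rule jordan_star_iso_inv)
  then have hom': "jordan_star_hom ?J'" by (simp add: jordan_star_iso_def)
  have J'J: "?J' (J F) = F" and JJ': "J (?J' G) = G" for F G
    using bij by (simp_all add: bij_is_inj bij_is_surj surj_f_inv_f)
  have center1: "\<exists>c. z = c *\<^sub>C 1" if "\<And>w. z * w = w * z" for z :: 'a1
    using primitive_center_trivial[OF assms(1) that] by blast
  have center2: "\<exists>c. z = c *\<^sub>C 1" if "\<And>w. z * w = w * z" for z :: 'a2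
    using primitive_center_trivial[OF assms(2) that] by blast
  obtain \<phi> K where \<phi>_lip: "K-lipschitz_on UNIV \<phi>"
    and \<phi>: "\<And>f y. lipschitz_fun f \<Longrightarrow> lip_apply (J (lip_scalar f)) y = f (\<phi> y) *\<^sub>R 1"
    and \<phi>0: "\<And>F y. lip_apply F (\<phi> y) = 0 \<Longrightarrow> lip_apply (J F) y = 0"
    using jordan_star_iso_point_map[OF J bl center2] by metis
  obtain \<psi> K' where \<psi>_lip: "K'-lipschitz_on UNIV \<psi>"
    and \<psi>: "\<And>f x. lipschitz_fun f \<Longrightarrow> lip_apply (?J' (lip_scalar f)) x = f (\<psi> x) *\<^sub>R 1"
    and \<psi>0: "\<And>G x. lip_apply G (\<psi> x) = 0 \<Longrightarrow> lip_apply (?J' G) x = 0"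
    using jordan_star_iso_point_map[OF J' bl' center1] by metis
  have \<phi>\<psi>: "\<phi> (\<psi> x) = x" for x by (rule point_maps_inverse[of ?J' J, OF J'J \<phi> \<psi>])
  have \<psi>\<phi>: "\<psi> (\<phi> y) = y" for y by (rule point_maps_inverse[of J ?J', OF JJ' \<psi> \<phi>])
  have bij_\<phi>: "bij \<phi>" using \<phi>\<psi> \<psi>\<phi> by (intro o_bij[of \<psi>]) auto
  have inv_\<phi>: "inv \<phi> = \<psi>" using \<phi>\<psi> \<psi>\<phi> by (intro inv_unique_comp) auto
  define V where "V y a = lip_apply (J (lip_const a)) y" for y a
  define W where "W x b = lip_apply (?J' (lip_const b)) x" for x b
  \<comment> \<open>\<open>F\<close> minus the constant with its value at \<open>\<phi> y\<close>
    vanishes there, so \<open>J\<close> cannot distinguish the two at \<open>y\<close>.\<close>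
  have JV: "lip_apply (J F) y = V y (lip_apply F (\<phi> y))" for F y
    using \<phi>0[of "F - lip_const (lip_apply F (\<phi> y))" y]
    by (simp add: V_def jordan_star_homD(6)[OF hom] lip_rep_eqs)
  have J'W: "lip_apply (?J' G) x = W x (lip_apply G (\<psi> x))" for G x
    using \<psi>0[of "G - lip_const (lip_apply G (\<psi> x))" x]
    by (simp add: W_def jordan_star_homD(6)[OF hom'] lip_rep_eqs)
  have VW: "V y (W (\<phi> y) b) = b" for y b
    using JV[of "?J' (lip_const b)" y] by (simp add: W_def JJ')
  have WV: "W (\<phi> y) (V y a) = a" for y a
    using J'W[of "J (lip_const a)" "\<phi> y"] by (simp add: V_def J'J \<psi>\<phi>)
  have bij_V: "bij (V y)" for y using VW WV by (intro o_bij[of "W (\<phi> y)"]) auto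
  have inv_V: "inv (V y) = W (\<phi> y)" for y using VW WV by (intro inv_unique_comp) auto
  have "jordan_star_iso (V y)" for y
    using bij_V
    by (auto simp: jordan_star_iso_def jordan_star_hom_def V_def[abs_def] lip_const_add lip_const_scaleC
        lip_const_jordan_prod lip_const_star jordan_star_homD[OF hom] lip_rep_eqs lip_apply_jordan_prod)
  moreover have "sot_lipschitz V"
    using sot_lipschitz_constants[OF hom bl] by (simp add: V_def[abs_def])
  \<comment> \<open>The inverse family at \<open>x\<close> is
    \<open>W (\<phi> (\<psi> x)) = W x\<close>, the action of the bounded map \<open>inv J\<close>
    on constants.\<close>
  moreover have "sot_lipschitz (\<lambda>x. inv (V (inv \<phi> x)))"
    using sot_lipschitz_constants[OF hom' bl'] by (simp add: inv_\<phi> inv_V \<phi>\<psi> W_def[abs_def])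
  moreover have "lipeomorphism \<phi>"
    using bij_\<phi> \<phi>_lip \<psi>_lip by (auto simp: lipeomorphism_def inv_\<phi>)
  ultimately show ?R using JV by blast
qed

end
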